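(* Let $\{\pi_\alpha:\alpha\in A\}$ be an $m$-transversal family of projection-type operators $\pi_\alpha:\Omega\to X$ into an $m$-dimensional space $X$ with measure $h$, indexed by $A$ with probability measure $\psi$. Fix a positive Borel probability measure $\mu$ supported on a compact set $F\subseteq\Omega$ so that $$\mu(B(x,r))\lesssim r^t$$ for all $x\in\Omega$ and $0<r<\infty$. (i) If $t<m$, then $\displaystyle\int_A h(\pi_\alpha F(r))\,d\psi(\alpha)\gtrsim r^{m-t}$. (ii) If $t=m$, then $\displaystyle\int_A h(\pi_\alpha F(r))\,d\psi(\alpha)\gtrsim(\log r^{-1})^{-1}$.
   Context: $F(r)$ denotes the $r$-neighborhood of $F$, and $\pi_\alpha F(r)$ its image under $\pi_\alpha$. $P\lesssim Q$ (equivalently $Q\gtrsim P$) means that there is a constant $C$, independent of $r$ (and of $x$), with $P\le CQ$. Family of projection-type operators: for $1\le m<n$ ($m$ an integer), the data consist of a domain $\Omega$ contained in $\mathbb{R}^n$; a codomain $X$ contained in a Euclidean space together with a Borel measure $h$ on $X$ such that $h(B(x,\delta))\gtrsim\delta^m$ for all $x\in X$ and $\delta\in(0,1)$, with constant independent of $x$ and $\delta$ (this is the sense in which $X$ is $m$-dimensional); an indexing set $A$ contained in a Euclidean space, equipped with a compactly supported probability measure $\psi$; and maps $\pi_\alpha:\Omega\to X$, $\alpha\in A$, such that $(p,\alpha)\mapsto\pi_\alpha(p)$ is continuous. For a given $s\ge0$, such a family is $s$-transversal if there exist constants $c>0$ and $\delta_0>0$ so that for all distinct $x,y\in\Omega$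 and $0<\delta\le\delta_0$, $$\psi\{\alpha: |\pi_\alpha(x)-\pi_\alpha(y)|\le\delta|x-y|\}<c\,\delta^m|x-y|^{m-s},$$ or equivalently $$\psi\{\alpha: |\pi_\alpha(x)-\pi_\alpha(y)|\le\delta\}<c\,\frac{\delta^m}{|x-y|^s}.$$ "$m$-transversal" means this holds with $s=m$.
   Formalization: The Borel measure h is assumed locally finite on X (each point has a ball of finite measure), without which the claim is false; the bounds are stated for those r with F(r) contained in Ω, where π_α F(r) is defined, and in (ii) for r ≤ r0 with any fixed r0 < 1. *)

theory Defs
  imports "HOL-Probability.Probability"
begin

definition nbhd :: "'a::metric_space set \<Rightarrow> real \<Rightarrow> 'a set" where
  "nbhd F r = (\<Union>x\<in>F. ball x r)"

(* The ambient space of \<Omega> is 'a, so n = DIM('a).  The measures h and \<psi> live on the subspace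
   Borel sigma-algebras of X and A, which need not be Borel subsets of their ambient spaces.
   "Borel measure" is taken to include local finiteness: without it h can be infinite on every
   ball while vanishing on all the images \<pi> \<alpha> ` \<Omega>, e.g. the counting measure of a countable
   dense set missing these images. *)
locale projection_family = psi: prob_space \<psi>
  for \<Omega> :: "'a::euclidean_space set"
    and X :: "'b::euclidean_space set" and h :: "'b measure"
    and A :: "'c::euclidean_space set" and \<psi> :: "'c measure"
    and \<pi> :: "'c \<Rightarrow> 'a \<Rightarrow> 'b" and m :: nat +
  assumes dim: "1 \<le> m" "m < DIM('a)"
    and sets_h: "sets h = sets (restrict_space borel X)"
    and h_locally_finite: "\<forall>x\<in>X. \<exists>\<delta>>0. emeasure h (X \<inter> ball x \<delta>) < \<infinity>"
    and h_lower: "\<exists>C>0. \<forall>x\<in>X. \<forall>\<delta>\<in>{0<..<1}. 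
                    ennreal (\<delta> ^ m) \<le> ennreal C * emeasure h (X \<inter> ball x \<delta>)"
    and sets_psi: "sets \<psi> = sets (restrict_space borel A)"
    and psi_compact_support: "\<exists>K. compact K \<and> K \<subseteq> A \<and> emeasure \<psi> (A - K) = 0"
    and maps: "\<forall>\<alpha>\<in>A. \<pi> \<alpha> ` \<Omega> \<subseteq> X"
    and continuous: "continuous_on (\<Omega> \<times> A) (\<lambda>(p, \<alpha>). \<pi> \<alpha> p)"

definition transversal ::
  "'a::euclidean_space set \<Rightarrow> 'c::euclidean_space set \<Rightarrow> 'c measure \<Rightarrow>
   ('c \<Rightarrow> 'a \<Rightarrow> 'b::euclidean_space) \<Rightarrow> nat \<Rightarrow> real \<Rightarrow> bool" where
  "transversal \<Omega> A \<psi> \<pi> m s \<longleftrightarrow>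
    (\<exists>c>0. \<exists>\<delta>0>0. \<forall>x\<in>\<Omega>. \<forall>y\<in>\<Omega>. \<forall>\<delta>. x \<noteq> y \<and> 0 < \<delta> \<and> \<delta> \<le> \<delta>0 \<longrightarrow>
       measure \<psi> {\<alpha>\<in>A. norm (\<pi> \<alpha> x - \<pi> \<alpha> y) \<le> \<delta> * norm (x - y)}
         < c * \<delta> ^ m * norm (x - y) powr (real m - s))"

end

theory Submission
  imports Defs
begin

text \<open>
  Smoothing \<open>\<mu>\<close> with the uniform distribution on a ball of radius \<open>r/2\<close> gives a probability measure \<open>\<nu>\<close>
  on a compact subset of \<open>F(r)\<close>. Since \<open>m < n\<close>, smoothing cuts off the Riesz kernel \<open>|x - y|\<^sup>-\<^sup>m\<close> at scale
  \<open>r\<close>, so the growth of \<open>\<mu>\<close> bounds the \<open>m\<close>-energy \<open>I\<close> of \<open>\<nu>\<close> by a multiple of \<open>r\<^sup>t\<^sup>-\<^sup>m\<close> if \<open>t < m\<close> and of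
  \<open>log (1/r)\<close> if \<open>t = m\<close>. By transversality, Fubini and Fatou, the lower limit as \<open>\<delta> \<rightarrow> 0\<close> of
  \<open>\<delta>\<^sup>-\<^sup>m (\<nu> \<times> \<nu>){(x, y). |\<pi>\<^sub>\<alpha> x - \<pi>\<^sub>\<alpha> y| \<le> \<delta>}\<close> has mean at most a multiple of \<open>I\<close>, hence is at most
  a multiple of \<open>I\<close> for a set of \<open>\<alpha>\<close> of probability at least \<open>1/2\<close>. For such \<open>\<alpha>\<close> the image measure of
  \<open>\<nu>\<close> is spread over so many disjoint \<open>\<delta>\<close>-balls that the \<open>\<delta>\<close>-neighbourhood of the compact image has
  \<open>h\<close>-measure at least a multiple of \<open>1/I\<close>; let \<open>\<delta> \<rightarrow> 0\<close>.
\<close>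

subsection \<open>Measures spread over small balls\<close>

text \<open>Markov's inequality at twice the mean bound: the points of \<open>K\<close> left out
  have mass at most 1/2. The conclusion is multiplied by 2 so that no division in
  \<open>ennreal\<close> occurs. It serves twice, for image measures in the target and for
  \<open>\<psi>\<close> on \<open>A\<close>.\<close>

lemma half_concentration:
  fixes \<phi> :: "'a \<Rightarrow> ennreal"
  assumes "prob_space \<nu>" and [measurable]: "\<phi> \<in> borel_measurable \<nu>"
    and "0 < c" and bound: "(\<integral>\<^sup>+z. \<phi> z \<partial>\<nu>) \<le> ennreal c"
    and K: "K \<in> sets \<nu>" "emeasure \<nu> K = 1"
  shows "1 \<le> 2 * emeasure \<nu> {z \<in> K. \<phi> z \<le> ennreal (2 * c)}"
proof -
  interpret prob_space \<nu> by fact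
  have [measurable]: "K \<in> sets \<nu>" by fact
  have sp: "K \<subseteq> space \<nu>" using K sets.sets_into_space by blast
  let ?G = "{z \<in> space \<nu>. z \<in> K \<and> \<phi> z \<le> ennreal (2 * c)}"
  let ?B = "{z \<in> space \<nu>. ennreal (2 * c) < \<phi> z}"
  have "ennreal (2 * c) * emeasure \<nu> ?B = (\<integral>\<^sup>+z. ennreal (2 * c) * indicator ?B z \<partial>\<nu>)"
    by (subst nn_integral_cmult_indicator) auto
  also have "\<dots> \<le> (\<integral>\<^sup>+z. \<phi> z \<partial>\<nu>)"
    by (intro nn_integral_mono) (auto simp: indicator_def)
  also have "\<dots> \<le> ennreal c" by fact
  finally have "ennreal (2 * c * measure \<nu> ?B) \<le> ennreal c"
    using \<open>0 < c\<close> by (simp add: emeasure_eq_measure ennreal_mult)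
  then have B: "measure \<nu> ?B \<le> 1 / 2"
    using \<open>0 < c\<close> by (simp add: field_simps)
  have "K \<subseteq> ?G \<union> ?B" using sp by auto
  then have "measure \<nu> K \<le> measure \<nu> (?G \<union> ?B)"
    by (intro finite_measure_mono) auto
  also have "\<dots> \<le> measure \<nu> ?G + measure \<nu> ?B"
    by (intro measure_Un_le) auto
  finally have "measure \<nu> ?G \<ge> 1 / 2"
    using B K by (simp add: emeasure_eq_measure)
  then have "1 \<le> ennreal (2 * measure \<nu> ?G)" by (subst ennreal_ge_1) linarith
  moreover have "?G = {z \<in> K. \<phi> z \<le> ennreal (2 * c)}" using sp by auto
  ultimately show ?thesis by (simp add: emeasure_eq_measure ennreal_mult)
qed

text \<open>The mass of a ball is the integral of a section of the open set of pairs at distance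
  below \<open>\<delta>\<close>, so joint measurability and sigma-finiteness give the claim.\<close>

lemma measurable_emeasure_ball:
  fixes \<nu> :: "'a::euclidean_space measure"
  assumes "sigma_finite_measure \<nu>" and [measurable_cong]: "sets \<nu> = sets borel"
  shows "(\<lambda>z. emeasure \<nu> (ball z \<delta>)) \<in> borel_measurable borel"
proof -
  interpret sigma_finite_measure \<nu> by fact
  have "(\<lambda>z. emeasure \<nu> (ball z \<delta>)) = (\<lambda>z. \<integral>\<^sup>+y. indicator {p. dist (fst p) (snd p) < \<delta>} (z, y) \<partial>\<nu>)"
  proof
    fix z
    have "emeasure \<nu> (ball z \<delta>) = (\<integral>\<^sup>+y. indicator (ball z \<delta>) y \<partial>\<nu>)"
      using assms by simp
    also have "\<dots> = (\<integral>\<^sup>+y. indicator {p. dist (fst p) (snd p) < \<delta>} (z, y) \<partial>\<nu>)"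
      by (intro nn_integral_cong) (auto simp: indicator_def)
    finally show "emeasure \<nu> (ball z \<delta>) = \<dots>" .
  qed
  also have "\<dots> \<in> borel_measurable borel"
    by measurable
  finally show ?thesis .
qed

text \<open>Vitali covering: for half of the mass, balls of radius \<open>5 * \<delta>\<close> carry
  at most twice the mean bound, while a ball of radius \<open>\<delta>\<close> has
  \<open>h\<close>-measure at least \<open>\<delta> ^ m / C\<close>. These are compared ball by ball
  along a disjoint family whose fivefold enlargements cover that half. The factor 4 is the 2 of the
  Markov threshold times the 2 for half the mass.\<close>

lemma covering_bound:
  fixes K :: "'b::euclidean_space set"
  assumes "prob_space \<nu>" and sets_nu: "sets \<nu> = sets borel"
    and K: "K \<in> sets borel" "K \<subseteq> X" "emeasure \<nu> K = 1"
    and sets_h: "sets h = sets (restrict_space borel X)"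
    and lower: "\<And>x. x \<in> K \<Longrightarrow> ennreal (\<delta> ^ m) \<le> ennreal C * emeasure h (X \<inter> ball x \<delta>)"
    and pos: "0 < \<delta>" "0 < M" "0 < C"
    and bound: "(\<integral>\<^sup>+z. emeasure \<nu> (ball z (5 * \<delta>)) \<partial>\<nu>) \<le> ennreal (M * \<delta> ^ m)"
  shows "1 \<le> ennreal (4 * M * C) * emeasure h (X \<inter> (\<Union>z\<in>K. ball z \<delta>))"
proof -
  interpret prob_space \<nu> by fact
  define G where "G = {z \<in> K. emeasure \<nu> (ball z (5 * \<delta>)) \<le> ennreal (2 * (M * \<delta> ^ m))}"
  have half: "1 \<le> 2 * emeasure \<nu> G"
    unfolding G_def
  proof (rule half_concentration)
    show "(\<lambda>z. emeasure \<nu> (ball z (5 * \<delta>))) \<in> borel_measurable \<nu>"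
      using measurable_emeasure_ball[OF sigma_finite_measure_axioms sets_nu]
        sets_nu measurable_cong_sets by blast
  qed (use assms in auto)
  obtain D where D: "countable D" "D \<subseteq> G"
     "pairwise (\<lambda>i j. disjnt (ball i \<delta>) (ball j \<delta>)) D"
     "G \<subseteq> (\<Union>i\<in>D. ball i (5 * \<delta>))"
  proof (rule Vitali_covering_lemma_balls[where S = G and K = G and a = "\<lambda>i. i" and r = "\<lambda>_. \<delta>" and B = \<delta>])
    show "G \<subseteq> (\<Union>i\<in>G. ball i \<delta>)" using pos by auto
  qed (use pos in auto)
  \<comment> \<open>The possibly finite family \<open>D\<close> is indexed by \<open>nat\<close>,
    with empty sets outside \<open>I\<close>, so that countable additivity and subadditivity apply
    to sequences.\<close>
  define I where "I = to_nat_on D ` D"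
  define f where "f s n = (if n \<in> I then ball (from_nat_into D n) s else {})" for s n
  have fni: "from_nat_into D n \<in> D" if "n \<in> I" for n
    using that D(1) by (auto simp: I_def)
  have cover: "G \<subseteq> (\<Union>n. f (5 * \<delta>) n)"
  proof
    fix x assume "x \<in> G"
    then obtain i where "i \<in> D" "x \<in> ball i (5 * \<delta>)" using D(4) by blast
    then show "x \<in> (\<Union>n. f (5 * \<delta>) n)"
      using D(1) by (intro UN_I[of "to_nat_on D i"]) (auto simp: f_def I_def)
  qed
  have disj: "disjoint_family (\<lambda>n. X \<inter> f \<delta> n)"
  proof -
    have "f \<delta> a \<inter> f \<delta> b = {}" if "a \<noteq> b" for a b
    proof (cases "a \<in> I \<and> b \<in> I")
      case True
      then have "from_nat_into D a \<noteq> from_nat_into D b"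
        using that D(1) by (auto simp: I_def)
      then show ?thesis using D(3) fni True unfolding pairwise_def disjnt_def f_def by auto
    qed (auto simp: f_def)
    then show ?thesis unfolding disjoint_family_on_def by blast
  qed
  have hsets: "X \<inter> f s n \<in> sets h" for s n
    unfolding sets_h sets_restrict_space by (intro imageI) (auto simp: f_def)
  have hU: "X \<inter> (\<Union>z\<in>K. ball z \<delta>) \<in> sets h"
    unfolding sets_h sets_restrict_space by (intro imageI borel_open) auto
  have sub: "(\<Union>n. X \<inter> f \<delta> n) \<subseteq> X \<inter> (\<Union>z\<in>K. ball z \<delta>)"
    using fni D(2) by (fastforce simp: f_def G_def split: if_splits)
  \<comment> \<open>Membership in \<open>G\<close> bounds \<open>\<nu>\<close> from above, the
    hypothesis \<open>lower\<close> at the centre bounds \<open>h\<close> from below, and the common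
    factor \<open>\<delta> ^ m\<close> drops out.\<close>
  have term_le: "emeasure \<nu> (f (5 * \<delta>) n) \<le> ennreal (2 * M * C) * emeasure h (X \<inter> f \<delta> n)" for n
  proof (cases "n \<in> I")
    case True
    define z where "z = from_nat_into D n"
    have z: "z \<in> G" using fni[OF True] D(2) by (auto simp: z_def)
    have "emeasure \<nu> (f (5 * \<delta>) n) \<le> ennreal (2 * (M * \<delta> ^ m))"
      using z True by (simp add: f_def G_def z_def)
    also have "\<dots> = ennreal (2 * M) * ennreal (\<delta> ^ m)"
      using pos by (simp flip: ennreal_mult)
    also have "\<dots> \<le> ennreal (2 * M) * (ennreal C * emeasure h (X \<inter> ball z \<delta>))"
      using z by (intro mult_left_mono lower) (auto simp: G_def)
    also have "\<dots> = ennreal (2 * M * C) * emeasure h (X \<inter> f \<delta> n)"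
      using pos True by (simp add: f_def z_def ennreal_mult mult.assoc)
    finally show ?thesis .
  qed (simp add: f_def)
  have "emeasure \<nu> G \<le> emeasure \<nu> (\<Union>n. f (5 * \<delta>) n)"
    using cover by (intro emeasure_mono) (auto simp: sets_nu f_def)
  also have "\<dots> \<le> (\<Sum>n. emeasure \<nu> (f (5 * \<delta>) n))"
    by (intro emeasure_subadditive_countably) (auto simp: sets_nu f_def)
  also have "\<dots> \<le> (\<Sum>n. ennreal (2 * M * C) * emeasure h (X \<inter> f \<delta> n))"
    by (intro suminf_le term_le) auto
  also have "\<dots> = ennreal (2 * M * C) * emeasure h (\<Union>n. X \<inter> f \<delta> n)"
    using hsets disj by (simp add: suminf_emeasure image_subset_iff)
  also have "\<dots> \<le> ennreal (2 * M * C) * emeasure h (X \<inter> (\<Union>z\<in>K. ball z \<delta>))"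
    using sub hU by (intro mult_left_mono emeasure_mono) auto
  finally have "2 * emeasure \<nu> G \<le> 2 * (ennreal (2 * M * C) * emeasure h (X \<inter> (\<Union>z\<in>K. ball z \<delta>)))"
    by (intro mult_left_mono) auto
  also have "\<dots> = ennreal 2 * ennreal (2 * M * C) * emeasure h (X \<inter> (\<Union>z\<in>K. ball z \<delta>))"
    by (simp add: mult.assoc)
  also have "ennreal 2 * ennreal (2 * M * C) = ennreal (4 * M * C)"
    using pos by (subst ennreal_mult[symmetric]) auto
  finally show ?thesis using half by order
qed

text \<open>Compactness selects finitely many balls of finite measure, and their open union contains
  a uniform neighbourhood of \<open>K\<close>. This supplies the finiteness needed for continuity
  from above.\<close>

lemma locally_finite_near_compact:
  fixes K :: "'b::euclidean_space set"
  assumes "compact K" "K \<subseteq> X"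
    and sets_h: "sets h = sets (restrict_space borel X)"
    and fin: "\<forall>x\<in>X. \<exists>\<delta>>0. emeasure h (X \<inter> ball x \<delta>) < \<infinity>"
  obtains \<epsilon> where "0 < \<epsilon>" "emeasure h (X \<inter> (\<Union>z\<in>K. ball z \<epsilon>)) < \<infinity>"
proof -
  obtain d where d: "\<And>x. x \<in> X \<Longrightarrow> 0 < d x \<and> emeasure h (X \<inter> ball x (d x)) < \<infinity>"
    using fin by metis
  have "K \<subseteq> (\<Union>x\<in>K. ball x (d x))" using d assms(2) by force
  then obtain S where S: "S \<subseteq> K" "finite S" "K \<subseteq> (\<Union>x\<in>S. ball x (d x))"
    using compactE_image[OF assms(1), of K "\<lambda>x. ball x (d x)"] by blast
  have meas: "X \<inter> O' \<in> sets h" if "open O'" for O'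
    unfolding sets_h sets_restrict_space using that by (intro imageI) auto
  obtain \<epsilon> where \<epsilon>: "\<epsilon> > 0" "(\<Union>x\<in>K. ball x \<epsilon>) \<subseteq> (\<Union>x\<in>S. ball x (d x))"
    using compact_subset_open_imp_ball_epsilon_subset[OF assms(1) _ S(3)] by blast
  have "emeasure h (X \<inter> (\<Union>z\<in>K. ball z \<epsilon>)) \<le> emeasure h (\<Union>x\<in>S. X \<inter> ball x (d x))"
    using \<epsilon> S by (intro emeasure_mono sets.finite_UN) (auto intro!: meas)
  also have "\<dots> \<le> (\<Sum>x\<in>S. emeasure h (X \<inter> ball x (d x)))"
    using S by (intro emeasure_subadditive_finite) (auto intro!: meas)
  also have "\<dots> < \<infinity>"
    using S d assms(2) by (auto simp: less_top[symmetric] subset_iff)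
  finally show ?thesis using \<epsilon> that by blast
qed

text \<open>Neighbourhoods of a compact set shrink to the set itself, so continuity from above
  carries the bound to the limit. A bound at infinitely many scales is enough because the
  neighbourhoods are nested.\<close>

lemma compact_measure_lower_bound:
  fixes K :: "'b::euclidean_space set"
  assumes "compact K" "K \<subseteq> X"
    and sets_h: "sets h = sets (restrict_space borel X)"
    and fin: "\<forall>x\<in>X. \<exists>\<delta>>0. emeasure h (X \<inter> ball x \<delta>) < \<infinity>"
    and lim: "\<delta> \<longlonglongrightarrow> 0" and dec: "decseq \<delta>" and pos: "\<And>k. 0 < \<delta> k"
    and freq: "\<exists>\<^sub>F k in sequentially. 1 \<le> ennreal c * emeasure h (X \<inter> (\<Union>z\<in>K. ball z (\<delta> k)))"
  shows "1 \<le> ennreal c * emeasure h K"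
proof (cases "K = {}")
  case True
  then show ?thesis using freq by simp
next
  case False
  obtain \<epsilon> where \<epsilon>: "0 < \<epsilon>" "emeasure h (X \<inter> (\<Union>z\<in>K. ball z \<epsilon>)) < \<infinity>"
    using locally_finite_near_compact[OF assms(1-4)] by blast
  define H where "H k = X \<inter> (\<Union>z\<in>K. ball z (\<delta> k))" for k
  have meas: "X \<inter> O' \<in> sets h" if "open O'" for O'
    unfolding sets_h sets_restrict_space using that by (intro imageI) auto
  have H_sets: "H k \<in> sets h" for k unfolding H_def by (intro meas) auto
  have mono: "H l \<subseteq> H k" if "k \<le> l" for k l
    unfolding H_def using decseqD[OF dec that] by fastforce
  have large: "1 \<le> ennreal c * emeasure h (H k)" for k
  proof -
    obtain l where "l \<ge> k" and l: "1 \<le> ennreal c * emeasure h (H l)"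
      using freq unfolding frequently_sequentially H_def by blast
    note l
    also have "ennreal c * emeasure h (H l) \<le> ennreal c * emeasure h (H k)"
      using mono[OF \<open>l \<ge> k\<close>] H_sets by (intro mult_left_mono emeasure_mono) auto
    finally show ?thesis .
  qed
  \<comment> \<open>Dropping the first \<open>N\<close> scales puts every neighbourhood inside the
    one of finite measure.\<close>
  obtain N where N: "\<And>k. k \<ge> N \<Longrightarrow> \<delta> k < \<epsilon>"
    using order_tendstoD(2)[OF lim \<epsilon>(1)] unfolding eventually_sequentially by blast
  have K_eq: "(\<Inter>k. H (k + N)) = K"
  proof
    show "K \<subseteq> (\<Inter>k. H (k + N))" 
    proof (intro subsetI INT_I)
      fix z k assume "z \<in> K"
      then show "z \<in> H (k + N)"
        using assms(2) pos[of "k + N"] by (auto simp: H_def intro!: bexI[of _ z])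
    qed
    show "(\<Inter>k. H (k + N)) \<subseteq> K"
    proof
      fix x assume x: "x \<in> (\<Inter>k. H (k + N))"
      have "infdist x K \<le> \<delta> (k + N)" for k
      proof -
        have "x \<in> H (k + N)" using x by blast
        then obtain z where "z \<in> K" "dist z x < \<delta> (k + N)" by (auto simp: H_def)
        then show ?thesis using infdist_le[of z K x] by (simp add: dist_commute)
      qed
      then have "infdist x K \<le> 0"
        using LIMSEQ_ignore_initial_segment[OF lim, of N] by (intro LIMSEQ_le_const) auto
      then show "x \<in> K"
        using in_closed_iff_infdist_zero[of K x] False assms(1) infdist_nonneg[of x K]
        by (auto simp: compact_imp_closed)
    qed
  qed
  have "(INF k. emeasure h (H (k + N))) = emeasure h (\<Inter>k. H (k + N))"
  proof (rule INF_emeasure_decseq)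
    show "decseq (\<lambda>k. H (k + N))" by (intro decseq_SucI mono) auto
    show "emeasure h (H (k + N)) \<noteq> \<infinity>" for k
    proof -
      have "emeasure h (H (k + N)) \<le> emeasure h (X \<inter> (\<Union>z\<in>K. ball z \<epsilon>))"
        unfolding H_def using N[of "k + N"] by (intro emeasure_mono meas) force+
      then show ?thesis using \<epsilon>(2) by (auto simp: top_unique)
    qed
  qed (use H_sets in auto)
  then have INF: "(INF k. emeasure h (H (k + N))) = emeasure h K" using K_eq by simp
  \<comment> \<open>For \<open>c \<le> 0\<close> the value \<open>ennreal c\<close> would be 0,
    contradicting \<open>large\<close>; division by \<open>c\<close> is therefore
    legitimate.\<close>
  have "0 < c"
    using large[of 0] by (cases "0 < c") (auto simp: ennreal_neg)
  have "ennreal (1 / c) \<le> emeasure h K"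
    unfolding INF[symmetric]
  proof (rule INF_greatest)
    fix k
    have "ennreal (1 / c) * 1 \<le> ennreal (1 / c) * (ennreal c * emeasure h (H (k + N)))"
      by (intro mult_left_mono large) auto
    also have "\<dots> = emeasure h (H (k + N))"
      using \<open>0 < c\<close> by (simp flip: mult.assoc ennreal_mult)
    finally show "ennreal (1 / c) \<le> emeasure h (H (k + N))" by simp
  qed
  then have "ennreal c * ennreal (1 / c) \<le> ennreal c * emeasure h K"
    by (intro mult_left_mono) auto
  then show ?thesis using \<open>0 < c\<close> by (simp flip: ennreal_mult)
qed

subsection \<open>Riesz energy and transversality\<close>

text \<open>The value at \<open>0\<close> is \<open>\<infinity>\<close> for \<open>m \<ge> 1\<close>, so finite energy rules out mass on the diagonal.\<close>
definition riesz_kernel :: "nat \<Rightarrow> 'a::real_normed_vector \<Rightarrow> ennreal" where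
  "riesz_kernel m a = inverse (ennreal (norm a ^ m))"

definition riesz_energy :: "nat \<Rightarrow> 'a::real_normed_vector measure \<Rightarrow> ennreal" where
  "riesz_energy m \<nu> = (\<integral>\<^sup>+x. \<integral>\<^sup>+y. riesz_kernel m (x - y) \<partial>\<nu> \<partial>\<nu>)"

lemma riesz_kernel_nonzero:
  "a \<noteq> 0 \<Longrightarrow> riesz_kernel m a = ennreal (1 / norm a ^ m)"
  by (simp add: riesz_kernel_def inverse_ennreal inverse_eq_divide)

lemma measurable_riesz_kernel [measurable]:
  "riesz_kernel m \<in> borel_measurable (borel :: 'a::euclidean_space measure)"
  unfolding riesz_kernel_def by measurable

context projection_family
begin

lemma space_psi: "space \<psi> = A"
  using sets_eq_imp_space_eq[OF sets_psi] by (simp add: space_restrict_space)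

lemma compact_image:
  assumes "\<alpha> \<in> A" "compact L" "L \<subseteq> \<Omega>"
  shows "compact (\<pi> \<alpha> ` L)"
proof (rule compact_continuous_image)
  have "continuous_on L (\<lambda>p. (\<lambda>(p, \<alpha>). \<pi> \<alpha> p) (p, \<alpha>))"
    by (rule continuous_on_compose2[OF continuous]) (use assms in \<open>auto intro!: continuous_intros\<close>)
  then show "continuous_on L (\<pi> \<alpha>)" by simp
qed fact

lemma image_subset_X: "\<alpha> \<in> A \<Longrightarrow> L \<subseteq> \<Omega> \<Longrightarrow> \<pi> \<alpha> ` L \<subseteq> X"
  using maps by blast

lemma compact_image_sets:
  assumes "\<alpha> \<in> A" "compact L" "L \<subseteq> \<Omega>"
  shows "\<pi> \<alpha> ` L \<in> sets h"
  unfolding sets_h sets_restrict_space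
  using compact_imp_closed[OF compact_image[OF assms]] image_subset_X[OF assms(1,3)]
  by (intro image_eqI[of _ _ "\<pi> \<alpha> ` L"]) auto

text \<open>An open set is a countable union of compact sets, hence so is its image. Measurability
  matters because \<open>emeasure\<close> is 0 by default on non-measurable sets, and monotonicity
  of \<open>h\<close> is later applied with such an image as the larger set.\<close>

lemma open_image_sets:
  assumes "\<alpha> \<in> A" "open U" "U \<subseteq> \<Omega>"
  shows "\<pi> \<alpha> ` U \<in> sets h"
proof -
  obtain L :: "nat \<Rightarrow> 'a set" where L: "\<And>n. compact (L n)" "(\<Union>n. L n) = U"
    using open_Union_compact_subsets[OF assms(2)] by metis
  have "\<pi> \<alpha> ` U = (\<Union>n. \<pi> \<alpha> ` L n)" using L(2) by blast
  also have "\<dots> \<in> sets h"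
    using L assms by (intro sets.countable_UN image_subsetI compact_image_sets) auto
  finally show ?thesis .
qed

text \<open>Two restrictions of \<open>transversal\<close> are removed: large scales cost only a
  constant, as a probability is at most 1, and on the diagonal the kernel is infinite. The result
  can be integrated over all pairs.\<close>

lemma transversal_kernel_bound:
  assumes "transversal \<Omega> A \<psi> \<pi> m (real m)"
  obtains c where "0 < c"
    "\<And>x y \<delta>. x \<in> \<Omega> \<Longrightarrow> y \<in> \<Omega> \<Longrightarrow> 0 < \<delta> \<Longrightarrow>
       emeasure \<psi> {\<alpha> \<in> A. norm (\<pi> \<alpha> x - \<pi> \<alpha> y) \<le> \<delta>} \<le> ennreal (c * \<delta> ^ m) * riesz_kernel m (x - y)"
proof -
  obtain c \<delta>0 where c: "0 < c" "0 < \<delta>0" and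
    tr: "\<And>x y \<delta>. x \<in> \<Omega> \<Longrightarrow> y \<in> \<Omega> \<Longrightarrow> x \<noteq> y \<Longrightarrow> 0 < \<delta> \<Longrightarrow> \<delta> \<le> \<delta>0 \<Longrightarrow>
       measure \<psi> {\<alpha>\<in>A. norm (\<pi> \<alpha> x - \<pi> \<alpha> y) \<le> \<delta> * norm (x - y)} < c * \<delta> ^ m * norm (x - y) powr (real m - real m)"
    using assms unfolding transversal_def by blast
  \<comment> \<open>The second entry makes the bound at least 1, hence trivial, once the relative
    scale exceeds \<open>\<delta>0\<close>.\<close>
  define C where "C = max c (1 / \<delta>0 ^ m)"
  have C: "c \<le> C" "1 / \<delta>0 ^ m \<le> C" "0 < C" using c by (auto simp: C_def)
  have "emeasure \<psi> {\<alpha> \<in> A. norm (\<pi> \<alpha> x - \<pi> \<alpha> y) \<le> \<delta>} \<le> ennreal (C * \<delta> ^ m) * riesz_kernel m (x - y)"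
    if xy: "x \<in> \<Omega>" "y \<in> \<Omega>" and \<delta>: "0 < \<delta>" for x y \<delta>
  proof (cases "x = y")
    case True
    \<comment> \<open>Here \<open>1 \<le> m\<close> is needed: it gives \<open>0 ^ m = 0\<close>,
      whose inverse in \<open>ennreal\<close> is infinite.\<close>
    then have "riesz_kernel m (x - y) = top"
      using dim by (simp add: riesz_kernel_def power_0_left)
    moreover have "0 < C * \<delta> ^ m" using C \<delta> by simp
    ultimately show ?thesis by (simp add: ennreal_mult_top ennreal_eq_0_iff not_le)
  next
    case False
    define s where "s = \<delta> / norm (x - y)"
    have s: "0 < s" "\<delta> = s * norm (x - y)" using False \<delta> by (auto simp: s_def)
    have "measure \<psi> {\<alpha> \<in> A. norm (\<pi> \<alpha> x - \<pi> \<alpha> y) \<le> \<delta>} \<le> C * s ^ m"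
    proof (cases "s \<le> \<delta>0")
      case True
      have "measure \<psi> {\<alpha> \<in> A. norm (\<pi> \<alpha> x - \<pi> \<alpha> y) \<le> \<delta>} < c * s ^ m"
        using tr[OF xy False s(1) True] False by (simp add: s(2))
      also have "\<dots> \<le> C * s ^ m" using C s by (intro mult_right_mono) auto
      finally show ?thesis by simp
    next
      case False
      have "1 = 1 / \<delta>0 ^ m * \<delta>0 ^ m" using c by simp
      also have "\<dots> \<le> C * s ^ m"
        using C False c by (intro mult_mono power_mono) auto
      finally show ?thesis using psi.prob_le_1 by (meson order_trans)
    qed
    also have "C * s ^ m = C * \<delta> ^ m * (1 / norm (x - y) ^ m)"
      by (simp add: s_def power_divide)
    finally have "ennreal (measure \<psi> {\<alpha> \<in> A. norm (\<pi> \<alpha> x - \<pi> \<alpha> y) \<le> \<delta>})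
        \<le> ennreal (C * \<delta> ^ m * (1 / norm (x - y) ^ m))"
      by (rule ennreal_leI)
    also have "\<dots> = ennreal (C * \<delta> ^ m) * riesz_kernel m (x - y)"
      using False C \<delta> by (subst ennreal_mult) (auto simp: riesz_kernel_nonzero)
    finally show ?thesis by (simp add: psi.emeasure_eq_measure)
  qed
  then show ?thesis using that C(3) by blast
qed

text \<open>Joint continuity on \<open>\<Omega> \<times> A\<close> gives joint measurability for the
  subspace sigma-algebras. The flip of coordinates only matches the argument order in
  \<open>continuous\<close>.\<close>

lemma measurable_projection:
  fixes \<nu> :: "'a measure"
  assumes "sets \<nu> = sets (restrict_space borel L)" "L \<subseteq> \<Omega>"
  shows "(\<lambda>(\<alpha>, x). \<pi> \<alpha> x) \<in> borel_measurable (\<psi> \<Otimes>\<^sub>M \<nu>)"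
proof -
  have sp: "space \<nu> = L"
    using sets_eq_imp_space_eq[OF assms(1)] by (simp add: space_restrict_space)
  have id1: "(\<lambda>x. x) \<in> borel_measurable \<nu>"
    using measurable_restrict_space1[OF measurable_ident_sets[OF refl], of borel L]
      measurable_cong_sets[OF assms(1) refl] by blast
  have id2: "(\<lambda>x. x) \<in> borel_measurable \<psi>"
    using measurable_restrict_space1[OF measurable_ident_sets[OF refl], of borel A]
      measurable_cong_sets[OF sets_psi refl] by blast
  have swap: "(\<lambda>(\<alpha>, x). (x, \<alpha>)) \<in> measurable (\<psi> \<Otimes>\<^sub>M \<nu>) borel"
    unfolding split_beta
    by (intro borel_measurable_Pair measurable_compose[OF measurable_fst id2]
        measurable_compose[OF measurable_snd id1])
  have "(\<lambda>(\<alpha>, x). (x, \<alpha>)) \<in> measurable (\<psi> \<Otimes>\<^sub>M \<nu>) (restrict_space borel (\<Omega> \<times> A))"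
    using sp space_psi assms(2)
    by (intro measurable_restrict_space2 swap) (auto simp: space_pair_measure)
  from measurable_compose[OF this borel_measurable_continuous_on_restrict[OF continuous]]
  show ?thesis by (simp add: split_beta)
qed


text \<open>Tonelli: integrating first over \<open>\<alpha>\<close> for a fixed pair of points turns
  transversality into the kernel, whose double integral is the energy. The measurability part
  prepares Fatou and Markov in \<open>\<alpha>\<close>.\<close>

lemma mean_projection_bound:
  fixes \<nu> :: "'a measure"
  assumes "prob_space \<nu>" and sets_nu: "sets \<nu> = sets (restrict_space borel L)" and "L \<subseteq> \<Omega>"
    and "0 < c" "0 < \<delta>"
    and tr: "\<And>x y. x \<in> \<Omega> \<Longrightarrow> y \<in> \<Omega> \<Longrightarrow>
       emeasure \<psi> {\<alpha> \<in> A. norm (\<pi> \<alpha> x - \<pi> \<alpha> y) \<le> \<delta>} \<le> ennreal c * riesz_kernel m (x - y)"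
  shows "(\<lambda>\<alpha>. emeasure (\<nu> \<Otimes>\<^sub>M \<nu>) {p \<in> L \<times> L. norm (\<pi> \<alpha> (fst p) - \<pi> \<alpha> (snd p)) \<le> \<delta>}) \<in> borel_measurable \<psi>"
    and "(\<integral>\<^sup>+\<alpha>. emeasure (\<nu> \<Otimes>\<^sub>M \<nu>) {p \<in> L \<times> L. norm (\<pi> \<alpha> (fst p) - \<pi> \<alpha> (snd p)) \<le> \<delta>} \<partial>\<psi>)
      \<le> ennreal c * riesz_energy m \<nu>"
proof -
  interpret nu: prob_space \<nu> by fact
  interpret P: pair_prob_space \<nu> \<nu> ..
  interpret Q: pair_prob_space \<psi> "\<nu> \<Otimes>\<^sub>M \<nu>" ..
  have sp: "space \<nu> = L"
    using sets_eq_imp_space_eq[OF sets_nu] by (simp add: space_restrict_space)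
  define J where "J \<alpha> = {p \<in> L \<times> L. norm (\<pi> \<alpha> (fst p) - \<pi> \<alpha> (snd p)) \<le> \<delta>}" for \<alpha>
  \<comment> \<open>\<open>D\<close> collects the triples of a parameter and two points with close
    projections. Its slices at fixed parameter are the sets \<open>J\<close>, and its slices at a
    fixed pair are the sets bounded by \<open>tr\<close>.\<close>
  define D where "D = {q \<in> space (\<psi> \<Otimes>\<^sub>M (\<nu> \<Otimes>\<^sub>M \<nu>)). norm (\<pi> (fst q) (fst (snd q)) - \<pi> (fst q) (snd (snd q))) \<le> \<delta>}"
  note pr = measurable_projection[OF sets_nu \<open>L \<subseteq> \<Omega>\<close>]
  have m1: "(\<lambda>q. \<pi> (fst q) (fst (snd q))) \<in> borel_measurable (\<psi> \<Otimes>\<^sub>M (\<nu> \<Otimes>\<^sub>M \<nu>))"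
    using measurable_compose[OF _ pr, of "\<lambda>q. (fst q, fst (snd q))" "\<psi> \<Otimes>\<^sub>M (\<nu> \<Otimes>\<^sub>M \<nu>)"] by simp
  have m2: "(\<lambda>q. \<pi> (fst q) (snd (snd q))) \<in> borel_measurable (\<psi> \<Otimes>\<^sub>M (\<nu> \<Otimes>\<^sub>M \<nu>))"
    using measurable_compose[OF _ pr, of "\<lambda>q. (fst q, snd (snd q))" "\<psi> \<Otimes>\<^sub>M (\<nu> \<Otimes>\<^sub>M \<nu>)"] by simp
  have D: "D \<in> sets (\<psi> \<Otimes>\<^sub>M (\<nu> \<Otimes>\<^sub>M \<nu>))"
    unfolding D_def using m1 m2 by measurable
  have slice: "Pair \<alpha> -` D = J \<alpha>" if "\<alpha> \<in> A" for \<alpha>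
    using that by (auto simp: D_def J_def space_pair_measure sp space_psi)
  have "(\<lambda>\<alpha>. emeasure (\<nu> \<Otimes>\<^sub>M \<nu>) (Pair \<alpha> -` D)) \<in> borel_measurable \<psi>"
    by (rule P.measurable_emeasure_Pair[OF D])
  then have "(\<lambda>\<alpha>. emeasure (\<nu> \<Otimes>\<^sub>M \<nu>) (J \<alpha>)) \<in> borel_measurable \<psi>"
    by (subst measurable_cong[where g = "\<lambda>\<alpha>. emeasure (\<nu> \<Otimes>\<^sub>M \<nu>) (Pair \<alpha> -` D)"]) (auto simp: slice space_psi)
  then show "(\<lambda>\<alpha>. emeasure (\<nu> \<Otimes>\<^sub>M \<nu>) {p \<in> L \<times> L. norm (\<pi> \<alpha> (fst p) - \<pi> \<alpha> (snd p)) \<le> \<delta>}) \<in> borel_measurable \<psi>"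
    unfolding J_def .
  have ker: "(\<lambda>p. riesz_kernel m (fst p - snd p)) \<in> borel_measurable (\<nu> \<Otimes>\<^sub>M \<nu>)"
  proof -
    have [measurable]: "(\<lambda>x. x) \<in> borel_measurable \<nu>"
      using measurable_restrict_space1[OF measurable_ident_sets[OF refl], of borel L]
        measurable_cong_sets[OF sets_nu refl] by blast
    have [measurable]: "fst \<in> borel_measurable (\<nu> \<Otimes>\<^sub>M \<nu>)" "snd \<in> borel_measurable (\<nu> \<Otimes>\<^sub>M \<nu>)"
      by (auto intro: measurable_compose[OF measurable_fst, of "\<lambda>x. x"]
          measurable_compose[OF measurable_snd, of "\<lambda>x. x"])
    show ?thesis by measurable
  qed
  have "(\<integral>\<^sup>+\<alpha>. emeasure (\<nu> \<Otimes>\<^sub>M \<nu>) (J \<alpha>) \<partial>\<psi>) = (\<integral>\<^sup>+\<alpha>. emeasure (\<nu> \<Otimes>\<^sub>M \<nu>) (Pair \<alpha> -` D) \<partial>\<psi>)"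
    by (intro nn_integral_cong) (simp add: slice space_psi)
  also have "\<dots> = (\<integral>\<^sup>+p. emeasure \<psi> ((\<lambda>\<alpha>. (\<alpha>, p)) -` D) \<partial>(\<nu> \<Otimes>\<^sub>M \<nu>))"
    using P.emeasure_pair_measure_alt[OF D] Q.emeasure_pair_measure_alt2[OF D] by simp
  also have "\<dots> \<le> (\<integral>\<^sup>+p. ennreal c * riesz_kernel m (fst p - snd p) \<partial>(\<nu> \<Otimes>\<^sub>M \<nu>))"
  proof (rule nn_integral_mono)
    fix p assume "p \<in> space (\<nu> \<Otimes>\<^sub>M \<nu>)"
    then obtain x y where p: "p = (x, y)" "x \<in> L" "y \<in> L" by (auto simp: space_pair_measure sp)
    have "(\<lambda>\<alpha>. (\<alpha>, p)) -` D = {\<alpha> \<in> A. norm (\<pi> \<alpha> x - \<pi> \<alpha> y) \<le> \<delta>}"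
      using p by (auto simp: D_def space_pair_measure sp space_psi)
    then show "emeasure \<psi> ((\<lambda>\<alpha>. (\<alpha>, p)) -` D) \<le> ennreal c * riesz_kernel m (fst p - snd p)"
      using tr[of x y] p \<open>L \<subseteq> \<Omega>\<close> by auto
  qed
  also have "\<dots> = ennreal c * riesz_energy m \<nu>"
    using nu.nn_integral_fst[OF ker] ker by (simp add: nn_integral_cmult riesz_energy_def)
  finally show "(\<integral>\<^sup>+\<alpha>. emeasure (\<nu> \<Otimes>\<^sub>M \<nu>) {p \<in> L \<times> L. norm (\<pi> \<alpha> (fst p) - \<pi> \<alpha> (snd p)) \<le> \<delta>} \<partial>\<psi>)
      \<le> ennreal c * riesz_energy m \<nu>" unfolding J_def .
qed

text \<open>Pulled back along the projection, the mean mass of a ball is the product measure of the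
  pairs with close images. Equality is lost only because the ball is open and the condition on pairs
  is closed.\<close>

lemma emeasure_ball_projection:
  fixes \<nu> :: "'a measure"
  assumes "prob_space \<nu>" and sets_nu: "sets \<nu> = sets (restrict_space borel L)" "L \<subseteq> \<Omega>" "\<alpha> \<in> A"
  shows "\<pi> \<alpha> \<in> borel_measurable \<nu>"
    and "(\<integral>\<^sup>+z. emeasure (distr \<nu> borel (\<pi> \<alpha>)) (ball z \<delta>) \<partial>distr \<nu> borel (\<pi> \<alpha>))
      \<le> emeasure (\<nu> \<Otimes>\<^sub>M \<nu>) {p \<in> L \<times> L. norm (\<pi> \<alpha> (fst p) - \<pi> \<alpha> (snd p)) \<le> \<delta>}"
proof -
  interpret nu: prob_space \<nu> by fact
  have sp: "space \<nu> = L"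
    using sets_eq_imp_space_eq[OF sets_nu(1)] by (simp add: space_restrict_space)
  show meas [measurable]: "\<pi> \<alpha> \<in> borel_measurable \<nu>"
    using measurable_compose[OF measurable_Pair1' measurable_projection[OF assms(2,3)]]
      assms(4) by (simp add: space_psi)
  interpret d: prob_space "distr \<nu> borel (\<pi> \<alpha>)" by (rule nu.prob_space_distr) measurable
  let ?J = "{p \<in> space (\<nu> \<Otimes>\<^sub>M \<nu>). norm (\<pi> \<alpha> (fst p) - \<pi> \<alpha> (snd p)) \<le> \<delta>}"
  have J: "?J \<in> sets (\<nu> \<Otimes>\<^sub>M \<nu>)" by measurable
  have "(\<lambda>z. emeasure (distr \<nu> borel (\<pi> \<alpha>)) (ball z \<delta>)) \<in> borel_measurable borel"
    by (rule measurable_emeasure_ball) (simp_all add: d.sigma_finite_measure_axioms)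
  then have "(\<integral>\<^sup>+z. emeasure (distr \<nu> borel (\<pi> \<alpha>)) (ball z \<delta>) \<partial>distr \<nu> borel (\<pi> \<alpha>))
      = (\<integral>\<^sup>+x. emeasure (distr \<nu> borel (\<pi> \<alpha>)) (ball (\<pi> \<alpha> x) \<delta>) \<partial>\<nu>)"
    by (subst nn_integral_distr) auto
  also have "\<dots> \<le> (\<integral>\<^sup>+x. emeasure \<nu> (Pair x -` ?J) \<partial>\<nu>)"
  proof (rule nn_integral_mono)
    fix x assume x: "x \<in> space \<nu>"
    have "emeasure (distr \<nu> borel (\<pi> \<alpha>)) (ball (\<pi> \<alpha> x) \<delta>) = emeasure \<nu> (\<pi> \<alpha> -` ball (\<pi> \<alpha> x) \<delta> \<inter> space \<nu>)"
      by (subst emeasure_distr) auto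
    also have "\<dots> \<le> emeasure \<nu> (Pair x -` ?J)"
      using x sets_Pair1[OF J, of x]
      by (intro emeasure_mono) (auto simp: space_pair_measure dist_norm)
    finally show "emeasure (distr \<nu> borel (\<pi> \<alpha>)) (ball (\<pi> \<alpha> x) \<delta>) \<le> emeasure \<nu> (Pair x -` ?J)" .
  qed
  also have "\<dots> = emeasure (\<nu> \<Otimes>\<^sub>M \<nu>) ?J"
    by (rule nu.emeasure_pair_measure_alt[OF J, symmetric])
  also have "?J = {p \<in> L \<times> L. norm (\<pi> \<alpha> (fst p) - \<pi> \<alpha> (snd p)) \<le> \<delta>}"
    by (simp add: space_pair_measure sp)
  finally show "(\<integral>\<^sup>+z. emeasure (distr \<nu> borel (\<pi> \<alpha>)) (ball z \<delta>) \<partial>distr \<nu> borel (\<pi> \<alpha>))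
      \<le> emeasure (\<nu> \<Otimes>\<^sub>M \<nu>) {p \<in> L \<times> L. norm (\<pi> \<alpha> (fst p) - \<pi> \<alpha> (snd p)) \<le> \<delta>}" .
qed

text \<open>The constant is chosen before \<open>\<nu>\<close>, \<open>L\<close> and
  \<open>E\<close>, so it is uniform over all smoothing radii. In the factor 24, 4 comes from
  \<open>covering_bound\<close>, 3 from a Markov threshold with strict room, and 2 from keeping only
  half of the parameters.\<close>

lemma expected_image_measure:
  assumes "transversal \<Omega> A \<psi> \<pi> m (real m)"
  obtains c where "0 < c"
    "\<And>\<nu> L E. prob_space \<nu> \<Longrightarrow> sets \<nu> = sets (restrict_space borel L) \<Longrightarrow> compact L \<Longrightarrow> L \<subseteq> \<Omega> \<Longrightarrow>
      0 < E \<Longrightarrow> riesz_energy m \<nu> \<le> ennreal E \<Longrightarrow>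
      1 \<le> ennreal (c * E) * (\<integral>\<^sup>+\<alpha>. emeasure h (\<pi> \<alpha> ` L) \<partial>\<psi>)"
proof -
  obtain c0 where c0: "0 < c0" and tr:
    "\<And>x y \<delta>. x \<in> \<Omega> \<Longrightarrow> y \<in> \<Omega> \<Longrightarrow> 0 < \<delta> \<Longrightarrow>
       emeasure \<psi> {\<alpha> \<in> A. norm (\<pi> \<alpha> x - \<pi> \<alpha> y) \<le> \<delta>} \<le> ennreal (c0 * \<delta> ^ m) * riesz_kernel m (x - y)"
    using transversal_kernel_bound[OF assms] by blast
  obtain C where C: "0 < C" and lower:
    "\<And>x \<delta>. x \<in> X \<Longrightarrow> \<delta> \<in> {0<..<1} \<Longrightarrow> ennreal (\<delta> ^ m) \<le> ennreal C * emeasure h (X \<inter> ball x \<delta>)"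
    using h_lower by blast
  \<comment> \<open>Pairs are counted at scale \<open>5 * \<delta> k\<close>, the enlarged radius of
    the Vitali covering; \<open>5 ^ m\<close> absorbs this.\<close>
  define c1 where "c1 = c0 * 5 ^ m"
  have c1: "0 < c1" using c0 by (simp add: c1_def)
  \<comment> \<open>The exponent \<open>Suc k\<close> keeps every scale strictly below 1, as
    \<open>h_lower\<close> demands.\<close>
  define \<delta> :: "nat \<Rightarrow> real" where "\<delta> k = (1 / 2) ^ Suc k" for k
  have \<delta>: "0 < \<delta> k" "\<delta> k < 1" for k
    unfolding \<delta>_def by (simp, rule power_Suc_less_one) auto
  have \<delta>_lim: "\<delta> \<longlonglongrightarrow> 0"
    unfolding \<delta>_def by (intro LIMSEQ_Suc LIMSEQ_power_zero) simp
  have \<delta>_dec: "decseq \<delta>"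
    by (intro decseq_SucI) (simp add: \<delta>_def)
  show ?thesis
  proof (rule that[of "24 * c1 * C"])
    fix \<nu> :: "'a measure" and L E
    assume nu: "prob_space \<nu>" "sets \<nu> = sets (restrict_space borel L)"
      and L: "compact L" "L \<subseteq> \<Omega>" and E: "0 < E" "riesz_energy m \<nu> \<le> ennreal E"
    interpret nu: prob_space \<nu> by fact
    have sp: "space \<nu> = L"
      using sets_eq_imp_space_eq[OF nu(2)] by (simp add: space_restrict_space)
    define J where "J k \<alpha> = emeasure (\<nu> \<Otimes>\<^sub>M \<nu>)
      {p \<in> L \<times> L. norm (\<pi> \<alpha> (fst p) - \<pi> \<alpha> (snd p)) \<le> 5 * \<delta> k}" for k \<alpha>
    have J: "J k \<in> borel_measurable \<psi>" "(\<integral>\<^sup>+\<alpha>. J k \<alpha> \<partial>\<psi>) \<le> ennreal (c1 * \<delta> k ^ m) * riesz_energy m \<nu>" for k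
    proof -
      have *: "0 < c1 * \<delta> k ^ m" "0 < 5 * \<delta> k" using c1 \<delta> by auto
      have "emeasure \<psi> {\<alpha> \<in> A. norm (\<pi> \<alpha> x - \<pi> \<alpha> y) \<le> 5 * \<delta> k}
          \<le> ennreal (c1 * \<delta> k ^ m) * riesz_kernel m (x - y)" if "x \<in> \<Omega>" "y \<in> \<Omega>" for x y
        using tr[OF that *(2)] by (simp add: c1_def power_mult_distrib mult.assoc)
      note mean_projection_bound[OF nu L(2) * this]
      then show "J k \<in> borel_measurable \<psi>" "(\<integral>\<^sup>+\<alpha>. J k \<alpha> \<partial>\<psi>) \<le> ennreal (c1 * \<delta> k ^ m) * riesz_energy m \<nu>"
        unfolding J_def by blast+
    qed
    define g where "g k \<alpha> = J k \<alpha> / ennreal (\<delta> k ^ m)" for k \<alpha>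
    have g_meas [measurable]: "g k \<in> borel_measurable \<psi>" for k
      unfolding g_def using J(1) by measurable
    have g_int: "(\<integral>\<^sup>+\<alpha>. g k \<alpha> \<partial>\<psi>) \<le> ennreal (c1 * E)" for k
    proof -
      have "(\<integral>\<^sup>+\<alpha>. g k \<alpha> \<partial>\<psi>) = (\<integral>\<^sup>+\<alpha>. J k \<alpha> \<partial>\<psi>) / ennreal (\<delta> k ^ m)"
        unfolding g_def by (rule nn_integral_divide) (rule J)
      also have "\<dots> \<le> ennreal (c1 * \<delta> k ^ m) * ennreal E / ennreal (\<delta> k ^ m)"
        using J(2)[of k] E(2) by (intro divide_right_mono_ennreal) (meson mult_left_mono order_trans zero_le)
      also have "\<dots> = ennreal (c1 * E)"
        using c1 E \<delta>[of k] by (simp add: divide_ennreal flip: ennreal_mult)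
      finally show ?thesis .
    qed
    \<comment> \<open>Fatou bounds the mean of this lower limit by \<open>c1 * E\<close>, so one
      good set of parameters serves without choosing a common scale.\<close>
    define \<phi> where "\<phi> \<alpha> = liminf (\<lambda>k. g k \<alpha>)" for \<alpha>
    have [measurable]: "\<phi> \<in> borel_measurable \<psi>" unfolding \<phi>_def by measurable
    have "(\<integral>\<^sup>+\<alpha>. \<phi> \<alpha> \<partial>\<psi>) \<le> liminf (\<lambda>k. \<integral>\<^sup>+\<alpha>. g k \<alpha> \<partial>\<psi>)"
      unfolding \<phi>_def by (rule nn_integral_liminf) measurable
    also have "\<dots> \<le> liminf (\<lambda>k. ennreal (c1 * E))"
      by (intro Liminf_mono always_eventually allI g_int)
    also have "\<dots> = ennreal (c1 * E)" by (simp add: Liminf_const)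
    finally have \<phi>_int: "(\<integral>\<^sup>+\<alpha>. \<phi> \<alpha> \<partial>\<psi>) \<le> ennreal (c1 * E)" .
    define G where "G = {\<alpha> \<in> A. \<phi> \<alpha> \<le> ennreal (2 * (c1 * E))}"
    have half: "1 \<le> 2 * emeasure \<psi> G"
      unfolding G_def
    proof (rule half_concentration[OF psi.prob_space_axioms _ _ \<phi>_int])
      show "A \<in> sets \<psi>" "emeasure \<psi> A = 1"
        using psi.emeasure_space_1 sets.top[of \<psi>] by (auto simp: space_psi)
    qed (use c1 E in auto)
    have "G = {\<alpha> \<in> space \<psi>. \<phi> \<alpha> \<le> ennreal (2 * (c1 * E))}" by (simp add: G_def space_psi)
    then have G_sets: "G \<in> sets \<psi>" by simp
    have large: "1 \<le> ennreal (4 * (3 * c1 * E) * C) * emeasure h (\<pi> \<alpha> ` L)" if "\<alpha> \<in> G" for \<alpha>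
    proof (rule compact_measure_lower_bound[OF _ _ sets_h h_locally_finite \<delta>_lim \<delta>_dec \<delta>(1)])
      have \<alpha>: "\<alpha> \<in> A" using that by (simp add: G_def)
      show cpt: "compact (\<pi> \<alpha> ` L)" and sub: "\<pi> \<alpha> ` L \<subseteq> X"
        using compact_image image_subset_X \<alpha> L by auto
      note pm = emeasure_ball_projection[OF nu L(2) \<alpha>]
      have borel_K: "\<pi> \<alpha> ` L \<in> sets borel" using cpt by (simp add: compact_imp_closed)
      have "\<phi> \<alpha> < ennreal (3 * c1 * E)"
      proof -
        have "\<phi> \<alpha> \<le> ennreal (2 * (c1 * E))" using that by (simp add: G_def)
        also have "\<dots> < ennreal (3 * c1 * E)" using c1 E by (intro ennreal_lessI) auto
        finally show ?thesis .
      qed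
      \<comment> \<open>A lower limit strictly below the threshold gives infinitely many good
        scales, which may depend on \<open>\<alpha>\<close>. Strictness is why 2 was raised to
        3.\<close>
      then have "\<exists>\<^sub>F k in sequentially. g k \<alpha> < ennreal (3 * c1 * E)"
        using Liminf_bounded[of "ennreal (3 * c1 * E)" "\<lambda>k. g k \<alpha>" sequentially]
        unfolding frequently_def \<phi>_def by (auto simp: not_less)
      then show "\<exists>\<^sub>F k in sequentially. 1 \<le> ennreal (4 * (3 * c1 * E) * C) * emeasure h (X \<inter> (\<Union>z\<in>\<pi> \<alpha> ` L. ball z (\<delta> k)))"
      proof (rule frequently_elim1)
        fix k assume k: "g k \<alpha> < ennreal (3 * c1 * E)"
        have "J k \<alpha> = g k \<alpha> * ennreal (\<delta> k ^ m)"
          using \<delta>[of k] by (simp add: g_def ennreal_divide_times)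
        also have "\<dots> \<le> ennreal (3 * c1 * E) * ennreal (\<delta> k ^ m)"
          using k by (intro mult_right_mono) auto
        also have "\<dots> = ennreal (3 * c1 * E * \<delta> k ^ m)"
          using c1 E \<delta>[of k] by (simp flip: ennreal_mult)
        finally have Jk: "J k \<alpha> \<le> ennreal (3 * c1 * E * \<delta> k ^ m)" .
        show "1 \<le> ennreal (4 * (3 * c1 * E) * C) * emeasure h (X \<inter> (\<Union>z\<in>\<pi> \<alpha> ` L. ball z (\<delta> k)))"
        proof (rule covering_bound[OF nu.prob_space_distr[OF pm(1)] _ borel_K sub _ sets_h])
          show "emeasure (distr \<nu> borel (\<pi> \<alpha>)) (\<pi> \<alpha> ` L) = 1"
          proof -
            have "\<pi> \<alpha> -` \<pi> \<alpha> ` L \<inter> space \<nu> = space \<nu>" using sp by auto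
            then show ?thesis
              using borel_K pm(1) nu.emeasure_space_1 by (simp add: emeasure_distr)
          qed
          show "ennreal (\<delta> k ^ m) \<le> ennreal C * emeasure h (X \<inter> ball x (\<delta> k))" if "x \<in> \<pi> \<alpha> ` L" for x
            using that sub \<delta>[of k] by (intro lower) auto
          show "(\<integral>\<^sup>+z. emeasure (distr \<nu> borel (\<pi> \<alpha>)) (ball z (5 * \<delta> k)) \<partial>distr \<nu> borel (\<pi> \<alpha>))
             \<le> ennreal (3 * c1 * E * \<delta> k ^ m)"
            using pm(2)[of "5 * \<delta> k"] Jk unfolding J_def by order
        qed (use c1 E C \<delta> in auto)
      qed
    qed
    define D where "D = 4 * (3 * c1 * E) * C"
    have D: "0 < D" using c1 E C by (simp add: D_def)
    \<comment> \<open>No measurability of \<open>\<alpha> \<mapsto> h(\<pi>\<^sub>\<alpha> L)\<close> is available; a measurable minorant suffices.\<close>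
    have "ennreal (1 / D) * emeasure \<psi> G = (\<integral>\<^sup>+\<alpha>. ennreal (1 / D) * indicator G \<alpha> \<partial>\<psi>)"
      using G_sets by (simp add: nn_integral_cmult_indicator)
    also have "\<dots> \<le> (\<integral>\<^sup>+\<alpha>. emeasure h (\<pi> \<alpha> ` L) \<partial>\<psi>)"
    proof (rule nn_integral_mono)
      fix \<alpha>
      have "ennreal (1 / D) \<le> emeasure h (\<pi> \<alpha> ` L)" if "\<alpha> \<in> G"
      proof -
        have "ennreal (1 / D) * 1 \<le> ennreal (1 / D) * (ennreal D * emeasure h (\<pi> \<alpha> ` L))"
          using large[OF that] unfolding D_def by (intro mult_left_mono) auto
        also have "\<dots> = emeasure h (\<pi> \<alpha> ` L)"
          using D by (simp flip: mult.assoc ennreal_mult)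
        finally show ?thesis by simp
      qed
      then show "ennreal (1 / D) * indicator G \<alpha> \<le> emeasure h (\<pi> \<alpha> ` L)"
        by (auto simp: indicator_def)
    qed
    finally have "ennreal (2 * D) * (ennreal (1 / D) * emeasure \<psi> G)
        \<le> ennreal (2 * D) * (\<integral>\<^sup>+\<alpha>. emeasure h (\<pi> \<alpha> ` L) \<partial>\<psi>)"
      by (intro mult_left_mono) auto
    moreover have "ennreal (2 * D) * (ennreal (1 / D) * emeasure \<psi> G) = 2 * emeasure \<psi> G"
      using D by (simp flip: mult.assoc ennreal_mult)
    moreover have "2 * D = 24 * c1 * C * E" by (simp add: D_def)
    ultimately show "1 \<le> ennreal (24 * c1 * C * E) * (\<integral>\<^sup>+\<alpha>. emeasure h (\<pi> \<alpha> ` L) \<partial>\<psi>)"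
      using half by simp
  qed (use c1 C in auto)
qed

end

subsection \<open>Energy of the smoothed measure\<close>

lemma dyadic_bracket:
  fixes x :: real
  assumes "1 \<le> x"
  obtains k :: nat where "2 ^ k \<le> x" "x < 2 ^ Suc k"
proof -
  obtain n :: nat where n: "x < 2 ^ n" using real_arch_pow[of 2 x] by auto
  define l where "l = (LEAST n. x < 2 ^ n)"
  have l: "x < 2 ^ l" unfolding l_def using n by (rule LeastI)
  then have "l \<noteq> 0" using assms by (intro notI) simp
  then obtain k where k: "l = Suc k" using not0_implies_Suc by blast
  have "\<not> x < 2 ^ k" using not_less_Least[of k "\<lambda>n. x < 2 ^ n"] k unfolding l_def by simp
  then show ?thesis using that[of k] l k by simp
qed

lemma suminf_indicator_ge:
  fixes f :: "nat \<Rightarrow> ennreal"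
  assumes "y \<in> S k"
  shows "f k \<le> (\<Sum>k. f k * indicator (S k) y)"
proof -
  define g where "g k = f k * indicator (S k) y" for k
  have "g k \<le> (\<Sum>k. g k)" using sum_le_suminf[of g "{k}"] by simp
  then show ?thesis using assms by (simp add: g_def)
qed

lemma nn_integral_suminf_indicator:
  fixes c :: "nat \<Rightarrow> ennreal"
  assumes [measurable]: "\<And>k. S k \<in> sets M"
  shows "(\<integral>\<^sup>+y. (\<Sum>k. c k * indicator (S k) y) \<partial>M) = (\<Sum>k. c k * emeasure M (S k))"
  by (subst nn_integral_suminf) (simp_all add: nn_integral_cmult_indicator)

lemma riesz_kernel_le:
  assumes "0 < s" "s \<le> norm a"
  shows "riesz_kernel m a \<le> ennreal (1 / s ^ m)"
proof -
  have "a \<noteq> 0" using assms by auto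
  then show ?thesis
    using assms by (auto simp: riesz_kernel_nonzero intro!: ennreal_leI divide_left_mono power_mono mult_pos_pos)
qed

text \<open>Dyadic decomposition of the singularity: inside radius \<open>\<rho>\<close>, the point
  lies in a shell between \<open>\<rho> / 2 ^ Suc k\<close> and \<open>\<rho> / 2 ^ k\<close>.
  Replacing shells by full balls only enlarges the sum and leaves ball volumes to compute.\<close>

lemma riesz_kernel_near_bound:
  assumes "0 < \<rho>" "a \<noteq> 0"
  shows "riesz_kernel m a \<le> ennreal (1 / \<rho> ^ m)
     + (\<Sum>k. ennreal ((2 ^ Suc k / \<rho>) ^ m) * indicator (cball 0 (\<rho> / 2 ^ k)) a)"
proof (cases "\<rho> \<le> norm a")
  case True
  then show ?thesis using riesz_kernel_le[OF assms(1) True, of m] by (simp add: add_increasing2)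
next
  case False
  then obtain k where k: "2 ^ k \<le> \<rho> / norm a" "\<rho> / norm a < 2 ^ Suc k"
    using dyadic_bracket[of "\<rho> / norm a"] assms by auto
  have a: "a \<in> cball 0 (\<rho> / 2 ^ k)" "\<rho> / 2 ^ Suc k \<le> norm a"
    using k assms by (auto simp: field_simps)
  have "riesz_kernel m a \<le> ennreal ((2 ^ Suc k / \<rho>) ^ m)"
    using riesz_kernel_le[OF _ a(2), of m] assms by (simp add: power_divide)
  also have "\<dots> \<le> (\<Sum>k. ennreal ((2 ^ Suc k / \<rho>) ^ m) * indicator (cball 0 (\<rho> / 2 ^ k)) a)"
    by (rule suminf_indicator_ge) (rule a)
  finally show ?thesis by (simp add: add_increasing)
qed

abbreviation uniform_cball :: "real \<Rightarrow> 'a::euclidean_space measure" where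
  "uniform_cball \<rho> \<equiv> uniform_measure lborel (cball 0 \<rho>)"

lemma prob_space_uniform_cball:
  "0 < \<rho> \<Longrightarrow> prob_space (uniform_cball \<rho> :: 'a::euclidean_space measure)"
  by (intro prob_space_uniform_measure) (auto simp: emeasure_cball ennreal_eq_0_iff not_le)

text \<open>The only place where \<open>m < n\<close> is used: it makes the kernel locally integrable.\<close>
lemma riesz_kernel_uniform_cball:
  fixes w :: "'a::euclidean_space"
  assumes "m < DIM('a)" "0 < \<rho>"
  shows "(\<integral>\<^sup>+v. riesz_kernel m (v - w) \<partial>uniform_cball \<rho>) \<le> ennreal ((1 + 2 * 2 ^ m) / \<rho> ^ m)"
proof -
  let ?n = "DIM('a)"
  define V where "V = unit_ball_vol (real ?n) * \<rho> ^ ?n"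
  have V: "0 < V" "emeasure lborel (cball 0 \<rho> :: 'a set) = ennreal V"
    using assms by (auto simp: V_def emeasure_cball)
  \<comment> \<open>The kernel grows like \<open>2 ^ (k * m)\<close> and the volume decays like
    \<open>2 ^ (- k * n)\<close> with \<open>n - m \<ge> 1\<close>, so the terms are dominated by a
    geometric series of ratio 1/2.\<close>
  have term_le: "ennreal ((2 ^ Suc k / \<rho>) ^ m) * emeasure lborel (cball w (\<rho> / 2 ^ k))
      \<le> ennreal (2 ^ m * V / \<rho> ^ m * (1 / 2) ^ k)" for k
  proof -
    have "(2 ^ k :: real) ^ 1 \<le> (2 ^ k) ^ (?n - m)"
      using assms(1) by (intro power_increasing) auto
    then have "1 / (2 ^ k) ^ (?n - m) \<le> (1 / 2 :: real) ^ k"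
      by (simp add: power_divide field_simps)
    then have "(2 ^ k :: real) ^ m / (2 ^ k) ^ ?n \<le> (1 / 2) ^ k"
      using assms(1) by (simp add: power_diff)
    then have "2 ^ m * V / \<rho> ^ m * ((2 ^ k) ^ m / (2 ^ k) ^ ?n) \<le> 2 ^ m * V / \<rho> ^ m * (1 / 2) ^ k"
      using V assms by (intro mult_left_mono) auto
    moreover have "(2 ^ Suc k / \<rho>) ^ m * (unit_ball_vol (real ?n) * (\<rho> / 2 ^ k) ^ ?n)
        = 2 ^ m * V / \<rho> ^ m * ((2 ^ k) ^ m / (2 ^ k) ^ ?n)"
      by (simp add: V_def power_divide power_mult_distrib)
    ultimately have "(2 ^ Suc k / \<rho>) ^ m * (unit_ball_vol (real ?n) * (\<rho> / 2 ^ k) ^ ?n)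
        \<le> 2 ^ m * V / \<rho> ^ m * (1 / 2) ^ k" by (simp only:)
    moreover have "ennreal ((2 ^ Suc k / \<rho>) ^ m) * emeasure lborel (cball w (\<rho> / 2 ^ k))
        = ennreal ((2 ^ Suc k / \<rho>) ^ m * (unit_ball_vol (real ?n) * (\<rho> / 2 ^ k) ^ ?n))"
      using assms by (subst ennreal_mult) (auto simp: emeasure_cball)
    ultimately show ?thesis by (simp only: ennreal_leI)
  qed
  have "(\<integral>\<^sup>+v. riesz_kernel m (v - w) * indicator (cball 0 \<rho>) v \<partial>lborel)
     \<le> (\<integral>\<^sup>+v. ennreal (1 / \<rho> ^ m) * indicator (cball 0 \<rho>) v
         + (\<Sum>k. ennreal ((2 ^ Suc k / \<rho>) ^ m) * indicator (cball w (\<rho> / 2 ^ k)) v) \<partial>lborel)"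
  proof (rule nn_integral_mono_AE)
    show "AE v in lborel. riesz_kernel m (v - w) * indicator (cball 0 \<rho>) v \<le>
        ennreal (1 / \<rho> ^ m) * indicator (cball 0 \<rho>) v
         + (\<Sum>k. ennreal ((2 ^ Suc k / \<rho>) ^ m) * indicator (cball w (\<rho> / 2 ^ k)) v)"
      \<comment> \<open>The pole \<open>v = w\<close>, where the kernel is infinite, is a Lebesgue
        null set.\<close>
      using AE_lborel_singleton[of w]
    proof eventually_elim
      fix v assume "v \<noteq> w"
      have eq: "indicator (cball 0 (\<rho> / 2 ^ k)) (v - w) = (indicator (cball w (\<rho> / 2 ^ k)) v :: ennreal)" for k
        by (simp add: indicator_def dist_norm norm_minus_commute)
      have "riesz_kernel m (v - w) \<le> ennreal (1 / \<rho> ^ m)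
         + (\<Sum>k. ennreal ((2 ^ Suc k / \<rho>) ^ m) * indicator (cball w (\<rho> / 2 ^ k)) v)"
        using riesz_kernel_near_bound[OF assms(2), of "v - w" m] \<open>v \<noteq> w\<close> unfolding eq by simp
      then show "riesz_kernel m (v - w) * indicator (cball 0 \<rho>) v \<le>
        ennreal (1 / \<rho> ^ m) * indicator (cball 0 \<rho>) v
         + (\<Sum>k. ennreal ((2 ^ Suc k / \<rho>) ^ m) * indicator (cball w (\<rho> / 2 ^ k)) v)"
        by (auto simp: indicator_def)
    qed
  qed
  also have "\<dots> = ennreal (1 / \<rho> ^ m) * ennreal V
      + (\<Sum>k. ennreal ((2 ^ Suc k / \<rho>) ^ m) * emeasure lborel (cball w (\<rho> / 2 ^ k)))"
  proof (subst nn_integral_add)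
    have [measurable]: "cball x s \<in> sets borel" for x :: 'a and s by simp
    show "(\<lambda>v :: 'a. ennreal (1 / \<rho> ^ m) * indicator (cball 0 \<rho>) v) \<in> borel_measurable lborel"
      and "(\<lambda>v. \<Sum>k. ennreal ((2 ^ Suc k / \<rho>) ^ m) * indicator (cball w (\<rho> / 2 ^ k)) v) \<in> borel_measurable lborel"
      by measurable
  qed (simp add: nn_integral_suminf_indicator nn_integral_cmult_indicator V(2) del: power_Suc)
  also have "\<dots> \<le> ennreal (1 / \<rho> ^ m) * ennreal V + (\<Sum>k. ennreal (2 ^ m * V / \<rho> ^ m * (1 / 2) ^ k))"
    by (intro add_left_mono suminf_le term_le) auto
  also have "(\<Sum>k. ennreal (2 ^ m * V / \<rho> ^ m * (1 / 2) ^ k)) = ennreal (2 ^ m * V / \<rho> ^ m * 2)"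
  proof (rule suminf_ennreal_eq)
    show "(\<lambda>k. 2 ^ m * V / \<rho> ^ m * (1 / 2) ^ k) sums (2 ^ m * V / \<rho> ^ m * 2)"
      using geometric_sums[of "1 / 2 :: real"] by (intro sums_mult) simp
  qed (use V assms in auto)
  also have "ennreal (1 / \<rho> ^ m) * ennreal V + ennreal (2 ^ m * V / \<rho> ^ m * 2)
      = ennreal ((1 + 2 * 2 ^ m) / \<rho> ^ m * V)"
    using V assms by (simp add: field_simps flip: ennreal_mult ennreal_plus)
  finally have "(\<integral>\<^sup>+v. riesz_kernel m (v - w) * indicator (cball 0 \<rho>) v \<partial>lborel) / ennreal V
      \<le> ennreal ((1 + 2 * 2 ^ m) / \<rho> ^ m * V) / ennreal V"
    by (rule divide_right_mono_ennreal)
  then show ?thesis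
    using V assms by (simp add: nn_integral_uniform_measure divide_ennreal)
qed

text \<open>For close points the average over \<open>v\<close> tames the pole; for points at
  distance at least \<open>4 * \<rho>\<close> the shifts change the distance by at most half.
  Averaging one shift suffices, so \<open>u\<close> is arbitrary in the ball. Indicators of balls
  appear because integration against \<open>\<mu>\<close> then needs only ball masses.\<close>

lemma riesz_kernel_averaged:
  fixes x u y :: "'a::euclidean_space"
  assumes "m < DIM('a)" "0 < \<rho>" "norm u \<le> \<rho>"
  shows "(\<integral>\<^sup>+v. riesz_kernel m (x + u - (y + v)) \<partial>uniform_cball \<rho>)
     \<le> (\<Sum>k. ennreal (2 ^ m * (1 + 2 * 2 ^ m) / (2 ^ k * \<rho>) ^ m) * indicator (ball x (2 ^ Suc k * \<rho>)) y)"
proof -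
  define D where "D = 2 ^ m * (1 + 2 * 2 ^ m :: real)"
  interpret U: prob_space "uniform_cball \<rho> :: 'a measure"
    using assms by (intro prob_space_uniform_cball)
  have ge: "ennreal (D / (2 ^ k * \<rho>) ^ m)
      \<le> (\<Sum>k. ennreal (D / (2 ^ k * \<rho>) ^ m) * indicator (ball x (2 ^ Suc k * \<rho>)) y)"
    if "dist x y < 2 ^ Suc k * \<rho>" for k
    by (rule suminf_indicator_ge) (use that in simp)
  have "\<exists>k. dist x y < 2 ^ Suc k * \<rho> \<and>
    (\<integral>\<^sup>+v. riesz_kernel m (x + u - (y + v)) \<partial>uniform_cball \<rho>) \<le> ennreal (D / (2 ^ k * \<rho>) ^ m)"
  proof (cases "dist x y < 4 * \<rho>")
    case True
    have "riesz_kernel m (x + u - (y + v)) = riesz_kernel m (v - (x + u - y))" for v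
      unfolding riesz_kernel_def by (subst norm_minus_commute) (simp add: algebra_simps)
    then have "(\<integral>\<^sup>+v. riesz_kernel m (x + u - (y + v)) \<partial>uniform_cball \<rho>) \<le> ennreal ((1 + 2 * 2 ^ m) / \<rho> ^ m)"
      using riesz_kernel_uniform_cball[OF assms(1,2), of "x + u - y"] by simp
    \<comment> \<open>The index 1 fits since \<open>2 ^ Suc 1 * \<rho> = 4 * \<rho>\<close>, and the
      factor \<open>2 ^ m\<close> in \<open>D\<close> compensates for the denominator
      \<open>(2 * \<rho>) ^ m\<close>.\<close>
    then show ?thesis using True
      by (intro exI[of _ 1]) (simp add: D_def power_mult_distrib)
  next
    case False
    then obtain k where k: "2 ^ k \<le> dist x y / \<rho>" "dist x y / \<rho> < 2 ^ Suc k"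
      using dyadic_bracket[of "dist x y / \<rho>"] assms by (auto simp: field_simps)
    have "AE v in uniform_cball \<rho>. riesz_kernel m (x + u - (y + v)) \<le> ennreal (D / (2 ^ k * \<rho>) ^ m)"
    proof (rule AE_uniform_measureI)
      show "AE v in lborel. v \<in> cball 0 \<rho> \<longrightarrow> riesz_kernel m (x + u - (y + v)) \<le> ennreal (D / (2 ^ k * \<rho>) ^ m)"
      proof (intro AE_I2 impI)
        fix v :: 'a assume "v \<in> cball 0 \<rho>"
        then have "norm (u - v) \<le> 2 * \<rho>"
          using norm_triangle_ineq4[of u v] assms by simp
        moreover have "dist x y \<le> norm (x + u - (y + v)) + norm (u - v)"
          using norm_triangle_ineq4[of "x + u - (y + v)" "u - v"] by (simp add: dist_norm algebra_simps)
        ultimately have "dist x y / 2 \<le> norm (x + u - (y + v))" using False by simp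
        moreover have "2 ^ k * \<rho> / 2 \<le> dist x y / 2" using k assms by (simp add: field_simps)
        ultimately have "riesz_kernel m (x + u - (y + v)) \<le> ennreal (1 / (2 ^ k * \<rho> / 2) ^ m)"
          using assms by (intro riesz_kernel_le) auto
        also have "1 / (2 ^ k * \<rho> / 2) ^ m = 2 ^ m / (2 ^ k * \<rho>) ^ m"
          by (simp add: power_divide)
        also have "2 ^ m / (2 ^ k * \<rho>) ^ m \<le> D / (2 ^ k * \<rho>) ^ m"
          unfolding D_def using assms by (intro divide_right_mono) (auto simp: mult_le_cancel_left1)
        finally show "riesz_kernel m (x + u - (y + v)) \<le> ennreal (D / (2 ^ k * \<rho>) ^ m)"
          by (simp add: ennreal_leI)
      qed
    qed simp
    then have "(\<integral>\<^sup>+v. riesz_kernel m (x + u - (y + v)) \<partial>uniform_cball \<rho>)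
        \<le> (\<integral>\<^sup>+v. ennreal (D / (2 ^ k * \<rho>) ^ m) \<partial>(uniform_cball \<rho> :: 'a measure))"
      by (rule nn_integral_mono_AE)
    also have "\<dots> = ennreal (D / (2 ^ k * \<rho>) ^ m)" using U.emeasure_space_1 by simp
    finally show ?thesis using k assms by (intro exI[of _ k]) (auto simp: field_simps)
  qed
  then show ?thesis unfolding D_def[symmetric] using ge order_trans by blast
qed

section \<open>Convolution of a measure with the uniform law on a ball, and its energy\<close>

definition smoothing :: "real \<Rightarrow> 'a::euclidean_space measure \<Rightarrow> 'a measure" where
  "smoothing \<rho> \<mu> = distr (\<mu> \<Otimes>\<^sub>M uniform_cball \<rho>) borel (\<lambda>(x, u). x + u)"

lemma sets_smoothing: "sets (smoothing \<rho> \<mu>) = sets borel"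
  by (simp add: smoothing_def)

lemma nn_integral_smoothing:
  fixes \<mu> :: "'a::euclidean_space measure"
  assumes [measurable_cong]: "sets \<mu> = sets borel" and [measurable]: "f \<in> borel_measurable borel" and "0 < \<rho>"
  shows "(\<integral>\<^sup>+z. f z \<partial>smoothing \<rho> \<mu>) = (\<integral>\<^sup>+x. \<integral>\<^sup>+u. f (x + u) \<partial>uniform_cball \<rho> \<partial>\<mu>)"
proof -
  interpret U: prob_space "uniform_cball \<rho> :: 'a measure"
    using assms by (intro prob_space_uniform_cball)
  have "(\<integral>\<^sup>+z. f z \<partial>smoothing \<rho> \<mu>) = (\<integral>\<^sup>+p. f (fst p + snd p) \<partial>(\<mu> \<Otimes>\<^sub>M uniform_cball \<rho>))"
    unfolding smoothing_def by (subst nn_integral_distr) (auto simp: split_beta)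
  also have "\<dots> = (\<integral>\<^sup>+x. \<integral>\<^sup>+u. f (fst (x, u) + snd (x, u)) \<partial>uniform_cball \<rho> \<partial>\<mu>)"
    by (rule U.nn_integral_fst[symmetric]) measurable
  finally show ?thesis by simp
qed

text \<open>The second point is averaged by \<open>riesz_kernel_averaged\<close>, the shift of the
  first enters only through \<open>norm u \<le> \<rho>\<close>. Integration over
  \<open>\<mu>\<close> turns indicators into ball masses, and the remaining integrals are of a
  constant against probability measures.\<close>

lemma riesz_energy_smoothing:
  fixes \<mu> :: "'a::euclidean_space measure"
  assumes "prob_space \<mu>" and sets_mu [measurable_cong]: "sets \<mu> = sets borel"
    and "m < DIM('a)" "0 < \<rho>"
    and bound: "AE x in \<mu>. (\<Sum>k. ennreal (1 / (2 ^ k * \<rho>) ^ m) * emeasure \<mu> (ball x (2 ^ Suc k * \<rho>))) \<le> B"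
  shows "riesz_energy m (smoothing \<rho> \<mu>) \<le> ennreal (2 ^ m * (1 + 2 * 2 ^ m)) * B"
proof -
  define D where "D = 2 ^ m * (1 + 2 * 2 ^ m :: real)"
  have D: "0 < D" by (auto simp: D_def intro!: mult_pos_pos add_pos_pos)
  interpret mu: prob_space \<mu> by fact
  interpret U: prob_space "uniform_cball \<rho> :: 'a measure"
    using assms by (intro prob_space_uniform_cball)
  have inner: "(\<integral>\<^sup>+w. riesz_kernel m (z - w) \<partial>smoothing \<rho> \<mu>)
      = (\<integral>\<^sup>+y. \<integral>\<^sup>+v. riesz_kernel m (z - (y + v)) \<partial>uniform_cball \<rho> \<partial>\<mu>)" for z
    by (rule nn_integral_smoothing[OF sets_mu _ assms(4)]) measurable
  have "sigma_finite_measure (smoothing \<rho> \<mu>)"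
  proof -
    interpret P: pair_prob_space \<mu> "uniform_cball \<rho> :: 'a measure" ..
    interpret S: prob_space "smoothing \<rho> \<mu>"
      unfolding smoothing_def by (rule P.prob_space_distr) measurable
    show ?thesis by (rule S.sigma_finite_measure_axioms)
  qed
  then interpret S: sigma_finite_measure "smoothing \<rho> \<mu>" .
  note [measurable_cong] = sets_smoothing
  have "riesz_energy m (smoothing \<rho> \<mu>) = (\<integral>\<^sup>+x. \<integral>\<^sup>+u. \<integral>\<^sup>+w. riesz_kernel m (x + u - w)
      \<partial>smoothing \<rho> \<mu> \<partial>uniform_cball \<rho> \<partial>\<mu>)"
    unfolding riesz_energy_def by (rule nn_integral_smoothing[OF sets_mu _ assms(4)]) measurable
  also have "\<dots> \<le> (\<integral>\<^sup>+x. \<integral>\<^sup>+u. ennreal D * B \<partial>(uniform_cball \<rho> :: 'a measure) \<partial>\<mu>)"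
  proof (intro nn_integral_mono_AE)
    have U_norm: "AE u in (uniform_cball \<rho> :: 'a measure). norm u \<le> \<rho>"
      by (rule AE_uniform_measureI) auto
    show "AE x in \<mu>. (\<integral>\<^sup>+u. \<integral>\<^sup>+w. riesz_kernel m (x + u - w) \<partial>smoothing \<rho> \<mu> \<partial>uniform_cball \<rho>)
      \<le> (\<integral>\<^sup>+u. ennreal D * B \<partial>(uniform_cball \<rho> :: 'a measure))"
      using bound
    proof eventually_elim
      fix x assume x: "(\<Sum>k. ennreal (1 / (2 ^ k * \<rho>) ^ m) * emeasure \<mu> (ball x (2 ^ Suc k * \<rho>))) \<le> B"
      show "(\<integral>\<^sup>+u. \<integral>\<^sup>+w. riesz_kernel m (x + u - w) \<partial>smoothing \<rho> \<mu> \<partial>uniform_cball \<rho>)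
        \<le> (\<integral>\<^sup>+u. ennreal D * B \<partial>(uniform_cball \<rho> :: 'a measure))"
      proof (rule nn_integral_mono_AE, use U_norm in eventually_elim)
        fix u :: 'a assume u: "norm u \<le> \<rho>"
        have "(\<integral>\<^sup>+w. riesz_kernel m (x + u - w) \<partial>smoothing \<rho> \<mu>)
          \<le> (\<integral>\<^sup>+y. (\<Sum>k. ennreal (D / (2 ^ k * \<rho>) ^ m) * indicator (ball x (2 ^ Suc k * \<rho>)) y) \<partial>\<mu>)"
          unfolding inner D_def by (intro nn_integral_mono riesz_kernel_averaged assms u)
        also have "\<dots> = (\<Sum>k. ennreal (D / (2 ^ k * \<rho>) ^ m) * emeasure \<mu> (ball x (2 ^ Suc k * \<rho>)))"
          by (rule nn_integral_suminf_indicator) (simp add: sets_mu)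
        also have "\<dots> = (\<Sum>k. ennreal D * (ennreal (1 / (2 ^ k * \<rho>) ^ m) * emeasure \<mu> (ball x (2 ^ Suc k * \<rho>))))"
          using D assms(4) by (simp flip: mult.assoc ennreal_mult)
        also have "\<dots> = ennreal D * (\<Sum>k. ennreal (1 / (2 ^ k * \<rho>) ^ m) * emeasure \<mu> (ball x (2 ^ Suc k * \<rho>)))"
          by (rule ennreal_suminf_cmult)
        also have "\<dots> \<le> ennreal D * B" using x by (rule mult_left_mono) simp
        finally show "(\<integral>\<^sup>+w. riesz_kernel m (x + u - w) \<partial>smoothing \<rho> \<mu>) \<le> ennreal D * B" .
      qed
    qed
  qed
  also have "\<dots> = ennreal D * B" using mu.emeasure_space_1 U.emeasure_space_1 by simp
  finally show ?thesis unfolding D_def .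
qed

text \<open>Half the radius makes the sum of \<open>F\<close> and a closed ball compact yet
  contained in the open neighbourhood, and it carries all the mass. Restriction to \<open>L\<close>
  is taken because the projections are controlled only on \<open>\<Omega>\<close>.\<close>

lemma smoothing_support:
  fixes \<mu> :: "'a::euclidean_space measure"
  assumes "prob_space \<mu>" "sets \<mu> = sets borel" "0 < r" "compact F" "emeasure \<mu> (- F) = 0"
  obtains L where "compact L" "L \<subseteq> nbhd F r" "prob_space (restrict_space (smoothing (r / 2) \<mu>) L)"
    "sets (restrict_space (smoothing (r / 2) \<mu>) L) = sets (restrict_space borel L)"
    "riesz_energy m (restrict_space (smoothing (r / 2) \<mu>) L) \<le> riesz_energy m (smoothing (r / 2) \<mu>)"
proof -
  note [measurable_cong] = assms(2)
  define L where "L = {x + u | x u. x \<in> F \<and> u \<in> cball 0 (r / 2)}"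
  interpret mu: prob_space \<mu> by fact
  interpret U: prob_space "uniform_cball (r / 2) :: 'a measure"
    using assms by (intro prob_space_uniform_cball) auto
  interpret P: pair_prob_space \<mu> "uniform_cball (r / 2) :: 'a measure" ..
  interpret S: prob_space "smoothing (r / 2) \<mu>"
    unfolding smoothing_def by (rule P.prob_space_distr) measurable
  have L: "compact L" unfolding L_def using assms by (intro compact_sums) auto
  then have L_sets: "L \<in> sets (smoothing (r / 2) \<mu>)"
    by (simp add: sets_smoothing compact_imp_closed)
  have "L \<subseteq> nbhd F r"
    unfolding L_def nbhd_def using assms(3) by (fastforce simp: dist_norm)
  have F_ae: "AE x in \<mu>. x \<in> F"
    using assms by (intro AE_I[of _ _ "- F"]) (auto simp: sets_eq_imp_space_eq[OF assms(2)] compact_imp_closed)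
  have "emeasure (smoothing (r / 2) \<mu>) L = (\<integral>\<^sup>+z. indicator L z \<partial>smoothing (r / 2) \<mu>)"
    using L_sets by simp
  also have "\<dots> = (\<integral>\<^sup>+x. \<integral>\<^sup>+u. indicator L (x + u) \<partial>uniform_cball (r / 2) \<partial>\<mu>)"
    using L assms by (intro nn_integral_smoothing) (auto simp: compact_imp_closed)
  also have "\<dots> = (\<integral>\<^sup>+x. 1 \<partial>\<mu>)"
  proof (rule nn_integral_cong_AE, use F_ae in eventually_elim)
    fix x assume "x \<in> F"
    then have "AE u in uniform_cball (r / 2). indicator L (x + u) = (1 :: ennreal)"
      by (intro AE_uniform_measureI) (auto simp: L_def indicator_def)
    then have "(\<integral>\<^sup>+u. indicator L (x + u) \<partial>uniform_cball (r / 2)) = (\<integral>\<^sup>+u. 1 \<partial>(uniform_cball (r / 2) :: 'a measure))"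
      by (rule nn_integral_cong_AE)
    then show "(\<integral>\<^sup>+u. indicator L (x + u) \<partial>uniform_cball (r / 2)) = 1"
      using U.emeasure_space_1 by simp
  qed
  finally have one: "emeasure (smoothing (r / 2) \<mu>) L = 1" using mu.emeasure_space_1 by simp
  show ?thesis
  proof (rule that[OF L \<open>L \<subseteq> nbhd F r\<close>])
    show "prob_space (restrict_space (smoothing (r / 2) \<mu>) L)"
      by (rule prob_space_restrict_space[OF L_sets one])
    show "sets (restrict_space (smoothing (r / 2) \<mu>) L) = sets (restrict_space borel L)"
      by (simp add: sets_restrict_space sets_smoothing)
    have "L \<inter> space (smoothing (r / 2) \<mu>) \<in> sets (smoothing (r / 2) \<mu>)" using L_sets by simp
    \<comment> \<open>Restricting inserts an indicator, which is at most 1, into both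
      integrals.\<close>
    then show "riesz_energy m (restrict_space (smoothing (r / 2) \<mu>) L) \<le> riesz_energy m (smoothing (r / 2) \<mu>)"
      unfolding riesz_energy_def nn_integral_restrict_space[OF \<open>L \<inter> _ \<in> _\<close>]
      by (intro nn_integral_mono order_trans[OF mult_right_le_one_le])
        (auto intro!: nn_integral_mono simp: indicator_def)
  qed
qed

section \<open>Dyadic sums under the growth condition\<close>

text \<open>Growth makes the terms geometric with ratio \<open>2 powr (t - real m)\<close>, below 1,
  so the smallest scale \<open>\<rho>\<close> dominates.\<close>

lemma dyadic_sum_subcritical:
  fixes C \<rho> t :: real
  assumes "prob_space \<mu>" "0 < C" "0 < \<rho>" "t < real m"
    and growth: "\<And>r. 0 < r \<Longrightarrow> measure \<mu> (ball x r) \<le> C * r powr t"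
  shows "(\<Sum>k. ennreal (1 / (2 ^ k * \<rho>) ^ m) * emeasure \<mu> (ball x (2 ^ Suc k * \<rho>)))
    \<le> ennreal (C * 2 powr t / (1 - 2 powr (t - real m)) * \<rho> powr (t - real m))"
proof -
  interpret prob_space \<mu> by fact
  define q :: real where "q = 2 powr (t - real m)"
  have q: "0 < q" "q < 1" using assms(4) powr_less_mono[of "t - real m" 0 2] by (auto simp: q_def)
  define a where "a = C * 2 powr t * \<rho> powr (t - real m)"
  have a: "0 < a" using assms by (simp add: a_def)
  have "ennreal (1 / (2 ^ k * \<rho>) ^ m) * emeasure \<mu> (ball x (2 ^ Suc k * \<rho>)) \<le> ennreal (a * q ^ k)" for k
  proof -
    have "1 / (2 ^ k * \<rho>) ^ m * measure \<mu> (ball x (2 ^ Suc k * \<rho>))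
        \<le> 1 / (2 ^ k * \<rho>) ^ m * (C * (2 ^ Suc k * \<rho>) powr t)"
      using assms by (intro mult_left_mono growth) auto
    also have "\<dots> = C * ((2 ^ Suc k * \<rho>) powr t / (2 ^ k * \<rho>) powr real m)"
      using assms by (simp add: powr_realpow)
    also have "(2 ^ Suc k * \<rho>) powr t = 2 powr t * (2 ^ k * \<rho>) powr t"
      using assms by (simp add: powr_mult mult.assoc)
    also have "2 powr t * (2 ^ k * \<rho>) powr t / (2 ^ k * \<rho>) powr real m = 2 powr t * (2 ^ k * \<rho>) powr (t - real m)"
      by (simp add: powr_diff)
    also have "(2 ^ k * \<rho>) powr (t - real m) = q ^ k * \<rho> powr (t - real m)"
      using assms by (simp add: q_def powr_mult powr_power mult.commute flip: powr_realpow) (simp add: powr_powr mult.commute)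
    finally have "1 / (2 ^ k * \<rho>) ^ m * measure \<mu> (ball x (2 ^ Suc k * \<rho>)) \<le> a * q ^ k"
      by (simp add: a_def mult_ac)
    then show ?thesis
      using assms by (simp add: emeasure_eq_measure ennreal_leI flip: ennreal_mult)
  qed
  then have "(\<Sum>k. ennreal (1 / (2 ^ k * \<rho>) ^ m) * emeasure \<mu> (ball x (2 ^ Suc k * \<rho>)))
      \<le> (\<Sum>k. ennreal (a * q ^ k))"
    by (intro suminf_le) auto
  also have "\<dots> = ennreal (a * (1 / (1 - q)))"
    using q a by (intro suminf_ennreal_eq sums_mult geometric_sums) auto
  finally show ?thesis by (simp add: a_def q_def mult_ac)
qed

text \<open>At the critical exponent every scale below 1 contributes the same amount, and there are
  about \<open>log 2 (1 / \<rho>)\<close> of them. Beyond scale 1 the total mass 1 is a better bound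
  and leaves a geometric tail of sum 2.\<close>

lemma dyadic_sum_critical:
  fixes C \<rho> :: real
  assumes "prob_space \<mu>" "0 < C" "0 < \<rho>" "\<rho> < 1" "1 \<le> m"
    and growth: "\<And>r. 0 < r \<Longrightarrow> measure \<mu> (ball x r) \<le> C * r ^ m"
  shows "(\<Sum>k. ennreal (1 / (2 ^ k * \<rho>) ^ m) * emeasure \<mu> (ball x (2 ^ Suc k * \<rho>)))
    \<le> ennreal (C * 2 ^ m * (log 2 (1 / \<rho>) + 1) + 2)"
proof -
  interpret prob_space \<mu> by fact
  \<comment> \<open>From index \<open>N\<close> on the scale \<open>2 ^ k * \<rho>\<close> is at
    least 1; rounding up costs the \<open>+ 1\<close> in the bound.\<close>
  define N where "N = nat \<lceil>log 2 (1 / \<rho>)\<rceil>"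
  have lg: "0 < log 2 (1 / \<rho>)" using assms by (subst zero_less_log_cancel_iff) auto
  have N: "log 2 (1 / \<rho>) \<le> real N" "real N \<le> log 2 (1 / \<rho>) + 1"
    using lg unfolding N_def by linarith+
  have "1 / \<rho> \<le> 2 powr real N" using N(1) assms by (simp add: log_le_iff)
  then have N2: "1 \<le> 2 ^ N * \<rho>" using assms by (simp add: powr_realpow field_simps)
  define f where "f k = (if k \<in> {..<N} then C * 2 ^ m else 0)" for k
  define g :: "nat \<Rightarrow> real" where "g k = (if k < N then 0 else (1 / 2) ^ (k - N))" for k
  have f: "f sums (real N * (C * 2 ^ m))"
    using sums_If_finite_set[of "{..<N}" "\<lambda>_. C * 2 ^ m"] by (simp add: f_def[abs_def])
  have "(\<lambda>k. g (k + N)) sums 2"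
    using geometric_sums[of "1 / 2 :: real"] by (simp add: g_def)
  then have g: "g sums 2"
    by (subst (asm) sums_iff_shift) (simp add: g_def)
  have "ennreal (1 / (2 ^ k * \<rho>) ^ m) * emeasure \<mu> (ball x (2 ^ Suc k * \<rho>)) \<le> ennreal (f k + g k)" for k
  proof -
    have "1 / (2 ^ k * \<rho>) ^ m * measure \<mu> (ball x (2 ^ Suc k * \<rho>)) \<le> f k + g k"
    proof (cases "k < N")
      case True
      have "1 / (2 ^ k * \<rho>) ^ m * measure \<mu> (ball x (2 ^ Suc k * \<rho>))
          \<le> 1 / (2 ^ k * \<rho>) ^ m * (C * (2 ^ Suc k * \<rho>) ^ m)"
        using assms by (intro mult_left_mono growth) auto
      also have "\<dots> = C * 2 ^ m" using assms by (simp add: power_mult_distrib)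
      finally show ?thesis using True by (simp add: f_def g_def)
    next
      case False
      have "2 ^ (k - N) * 1 \<le> 2 ^ (k - N) * (2 ^ N * \<rho>)"
        using N2 by (intro mult_left_mono) auto
      also have "\<dots> = 2 ^ k * \<rho>" using False by (simp flip: mult.assoc power_add)
      finally have ge: "2 ^ (k - N) \<le> 2 ^ k * \<rho>" by simp
      \<comment> \<open>The base is at least 1 and \<open>1 \<le> m\<close>, so the power may be
        bounded below by its base.\<close>
      also have "\<dots> \<le> (2 ^ k * \<rho>) ^ m"
      proof -
        have "1 \<le> 2 ^ k * \<rho>" using ge one_le_power[of "2::real" "k - N"] by linarith
        then show ?thesis using power_increasing[of 1 m "2 ^ k * \<rho>"] assms by simp
      qed
      finally have "1 / (2 ^ k * \<rho>) ^ m \<le> 1 / 2 ^ (k - N)"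
        by (intro divide_left_mono) (use assms in auto)
      then have "1 / (2 ^ k * \<rho>) ^ m * measure \<mu> (ball x (2 ^ Suc k * \<rho>)) \<le> 1 / 2 ^ (k - N) * 1"
        by (intro mult_mono) (use assms in auto)
      then show ?thesis using False by (simp add: f_def g_def power_divide)
    qed
    then show ?thesis
      using assms by (simp add: emeasure_eq_measure ennreal_leI flip: ennreal_mult)
  qed
  then have "(\<Sum>k. ennreal (1 / (2 ^ k * \<rho>) ^ m) * emeasure \<mu> (ball x (2 ^ Suc k * \<rho>)))
      \<le> (\<Sum>k. ennreal (f k + g k))"
    by (intro suminf_le) auto
  also have "\<dots> = ennreal (real N * (C * 2 ^ m) + 2)"
    using assms by (intro suminf_ennreal_eq sums_add f g) (auto simp: f_def g_def)
  also have "\<dots> \<le> ennreal (C * 2 ^ m * (log 2 (1 / \<rho>) + 1) + 2)"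
    using N(2) assms by (intro ennreal_leI) (simp add: mult_ac)
  finally show ?thesis .
qed

section \<open>From dyadic sums to the mean measure of projected neighbourhoods\<close>

text \<open>The interface between geometry and growth: \<open>c\<close> does not depend on
  \<open>r\<close> or \<open>B\<close>, so each regime of \<open>t\<close> only has to supply its
  own \<open>B\<close>. The sum is needed on \<open>F\<close> alone since \<open>\<mu>\<close> does
  not charge the complement.\<close>

lemma (in projection_family) nbhd_image_bound:
  fixes F :: "'a set" and \<mu> :: "'a measure"
  assumes "transversal \<Omega> A \<psi> \<pi> m (real m)"
    and mu: "prob_space \<mu>" "sets \<mu> = sets borel"
    and F: "compact F" "emeasure \<mu> (- F) = 0"
  obtains c where "0 < c"
    "\<And>r B. 0 < r \<Longrightarrow> nbhd F r \<subseteq> \<Omega> \<Longrightarrow> 0 < B \<Longrightarrow>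
       (\<And>x. x \<in> F \<Longrightarrow> (\<Sum>k. ennreal (1 / (2 ^ k * (r / 2)) ^ m) * emeasure \<mu> (ball x (2 ^ Suc k * (r / 2)))) \<le> ennreal B) \<Longrightarrow>
       ennreal (1 / B) \<le> ennreal c * (\<integral>\<^sup>+\<alpha>. emeasure h (\<pi> \<alpha> ` nbhd F r) \<partial>\<psi>)"
proof -
  obtain c where c: "0 < c" and energy:
    "\<And>\<nu> L E. prob_space \<nu> \<Longrightarrow> sets \<nu> = sets (restrict_space borel L) \<Longrightarrow> compact L \<Longrightarrow> L \<subseteq> \<Omega> \<Longrightarrow>
      0 < E \<Longrightarrow> riesz_energy m \<nu> \<le> ennreal E \<Longrightarrow>
      1 \<le> ennreal (c * E) * (\<integral>\<^sup>+\<alpha>. emeasure h (\<pi> \<alpha> ` L) \<partial>\<psi>)"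
    using expected_image_measure[OF assms(1)] by blast
  define D where "D = 2 ^ m * (1 + 2 * 2 ^ m :: real)"
  have D: "0 < D" by (auto simp: D_def intro!: mult_pos_pos add_pos_pos)
  show ?thesis
  proof (rule that[of "c * D"])
    fix r B :: real
    assume r: "0 < r" "nbhd F r \<subseteq> \<Omega>" and B: "0 < B" and
      bound: "\<And>x. x \<in> F \<Longrightarrow> (\<Sum>k. ennreal (1 / (2 ^ k * (r / 2)) ^ m) * emeasure \<mu> (ball x (2 ^ Suc k * (r / 2)))) \<le> ennreal B"
    obtain L where L: "compact L" "L \<subseteq> nbhd F r"
      "prob_space (restrict_space (smoothing (r / 2) \<mu>) L)"
      "sets (restrict_space (smoothing (r / 2) \<mu>) L) = sets (restrict_space borel L)"
      "riesz_energy m (restrict_space (smoothing (r / 2) \<mu>) L) \<le> riesz_energy m (smoothing (r / 2) \<mu>)"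
      using smoothing_support[OF mu r(1) F] by blast
    have F_ae: "AE x in \<mu>. x \<in> F"
      using F mu by (intro AE_I[of _ _ "- F"]) (auto simp: sets_eq_imp_space_eq[OF mu(2)] compact_imp_closed)
    note L(5)
    also have "riesz_energy m (smoothing (r / 2) \<mu>) \<le> ennreal D * ennreal B"
      unfolding D_def
      by (rule riesz_energy_smoothing[OF mu dim(2)]) (use r F_ae bound in \<open>auto elim!: eventually_mono\<close>)
    also have "\<dots> = ennreal (D * B)" using D B by (simp flip: ennreal_mult)
    finally have "1 \<le> ennreal (c * (D * B)) * (\<integral>\<^sup>+\<alpha>. emeasure h (\<pi> \<alpha> ` L) \<partial>\<psi>)"
      using L r D B by (intro energy[OF L(3,4)]) auto
    also have "\<dots> \<le> ennreal (c * (D * B)) * (\<integral>\<^sup>+\<alpha>. emeasure h (\<pi> \<alpha> ` nbhd F r) \<partial>\<psi>)"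
      using L(2) r(2) by (intro mult_left_mono nn_integral_mono emeasure_mono image_mono open_image_sets)
        (auto simp: space_psi nbhd_def)
    finally have "ennreal (1 / B) * 1 \<le> ennreal (1 / B) * (ennreal (c * (D * B)) * (\<integral>\<^sup>+\<alpha>. emeasure h (\<pi> \<alpha> ` nbhd F r) \<partial>\<psi>))"
      by (intro mult_left_mono) auto
    also have "\<dots> = ennreal (c * D) * (\<integral>\<^sup>+\<alpha>. emeasure h (\<pi> \<alpha> ` nbhd F r) \<partial>\<psi>)"
      using B c D by (simp flip: mult.assoc ennreal_mult)
    finally show "ennreal (1 / B) \<le> ennreal (c * D) * (\<integral>\<^sup>+\<alpha>. emeasure h (\<pi> \<alpha> ` nbhd F r) \<partial>\<psi>)" by simp
  qed (use c D in auto)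
qed

lemma ennreal_le_rescale:
  assumes "ennreal (1 / B) \<le> ennreal c * I" "0 < B" "0 < K" "0 \<le> c" "a * B \<le> K"
  shows "ennreal a \<le> ennreal (K * c) * I"
proof -
  have "ennreal a \<le> ennreal (K * (1 / B))"
    using assms by (intro ennreal_leI) (simp add: field_simps)
  also have "\<dots> = ennreal K * ennreal (1 / B)" using assms by (intro ennreal_mult) auto
  also have "\<dots> \<le> ennreal K * (ennreal c * I)" using assms by (intro mult_left_mono) auto
  also have "\<dots> = ennreal (K * c) * I" using assms by (simp add: ennreal_mult mult.assoc)
  finally show ?thesis .
qed

text \<open>Both parts insert a dyadic sum at scale \<open>r / 2\<close> into
  \<open>nbhd_image_bound\<close>. The condition \<open>nbhd F r \<subseteq> \<Omega>\<close> keeps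
  the projections defined on the whole neighbourhood. In the critical case the constant depends on
  \<open>r0\<close>, because the reciprocal logarithm is unbounded as \<open>r\<close> tends to
  1.\<close>

theorem theorem1p5:
  fixes \<Omega> F :: "'a::euclidean_space set"
    and X :: "'b::euclidean_space set" and h :: "'b measure"
    and A :: "'c::euclidean_space set" and \<psi> :: "'c measure"
    and \<pi> :: "'c \<Rightarrow> 'a \<Rightarrow> 'b" and m :: nat
    and \<mu> :: "'a measure" and t :: real
  assumes family: "projection_family \<Omega> X h A \<psi> \<pi> m"
    and transversal: "transversal \<Omega> A \<psi> \<pi> m (real m)"
    and mu: "prob_space \<mu>" "sets \<mu> = sets borel"
    and F: "compact F" "F \<subseteq> \<Omega>" "emeasure \<mu> (- F) = 0"
    and growth: "\<exists>C>0. \<forall>x\<in>\<Omega>. \<forall>r>0. measure \<mu> (ball x r) \<le> C * r powr t"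
  shows "(t < real m \<longrightarrow>
            (\<exists>C>0. \<forall>r>0. nbhd F r \<subseteq> \<Omega> \<longrightarrow>
               ennreal (r powr (real m - t)) \<le>
                 ennreal C * (\<integral>\<^sup>+\<alpha>. emeasure h (\<pi> \<alpha> ` nbhd F r) \<partial>\<psi>))) \<and>
         (t = real m \<longrightarrow>
            (\<forall>r0\<in>{0<..<1}. \<exists>C>0. \<forall>r\<in>{0<..r0}. nbhd F r \<subseteq> \<Omega> \<longrightarrow>
               ennreal (inverse (ln (inverse r))) \<le>
                 ennreal C * (\<integral>\<^sup>+\<alpha>. emeasure h (\<pi> \<alpha> ` nbhd F r) \<partial>\<psi>)))"
proof -
  interpret projection_family \<Omega> X h A \<psi> \<pi> m by fact
  obtain C where C: "0 < C" and gr: "\<And>x r. x \<in> F \<Longrightarrow> 0 < r \<Longrightarrow> measure \<mu> (ball x r) \<le> C * r powr t"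
    using growth F(2) by blast
  obtain c where c: "0 < c" and key:
    "\<And>r B. 0 < r \<Longrightarrow> nbhd F r \<subseteq> \<Omega> \<Longrightarrow> 0 < B \<Longrightarrow>
       (\<And>x. x \<in> F \<Longrightarrow> (\<Sum>k. ennreal (1 / (2 ^ k * (r / 2)) ^ m) * emeasure \<mu> (ball x (2 ^ Suc k * (r / 2)))) \<le> ennreal B) \<Longrightarrow>
       ennreal (1 / B) \<le> ennreal c * (\<integral>\<^sup>+\<alpha>. emeasure h (\<pi> \<alpha> ` nbhd F r) \<partial>\<psi>)"
    using nbhd_image_bound[OF transversal mu F(1,3)] by blast
  have "\<exists>C>0. \<forall>r>0. nbhd F r \<subseteq> \<Omega> \<longrightarrow> ennreal (r powr (real m - t)) \<le>
                 ennreal C * (\<integral>\<^sup>+\<alpha>. emeasure h (\<pi> \<alpha> ` nbhd F r) \<partial>\<psi>)"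
    if t: "t < real m"
  proof -
    define b where "b = C * 2 powr t / (1 - 2 powr (t - real m))"
    have b: "0 < b"
      using C t powr_less_mono[of "t - real m" 0 2] by (auto simp: b_def)
    \<comment> \<open>The power of 1/2 accounts for passing from scale \<open>r\<close> to
      \<open>r / 2\<close>.\<close>
    define K where "K = b * (1 / 2) powr (t - real m)"
    have K: "0 < K" using b by (simp add: K_def)
    have "ennreal (r powr (real m - t)) \<le> ennreal (K * c) * (\<integral>\<^sup>+\<alpha>. emeasure h (\<pi> \<alpha> ` nbhd F r) \<partial>\<psi>)"
      if r: "0 < r" "nbhd F r \<subseteq> \<Omega>" for r
    proof (rule ennreal_le_rescale)
      show "ennreal (1 / (b * (r / 2) powr (t - real m))) \<le> ennreal c * (\<integral>\<^sup>+\<alpha>. emeasure h (\<pi> \<alpha> ` nbhd F r) \<partial>\<psi>)"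
      proof (rule key[OF r])
        show "0 < b * (r / 2) powr (t - real m)" using r b by simp
        fix x assume "x \<in> F"
        then show "(\<Sum>k. ennreal (1 / (2 ^ k * (r / 2)) ^ m) * emeasure \<mu> (ball x (2 ^ Suc k * (r / 2))))
            \<le> ennreal (b * (r / 2) powr (t - real m))"
          unfolding b_def using r C t gr by (intro dyadic_sum_subcritical mu) auto
      qed
      have halve: "(r / 2) powr (t - real m) = r powr (t - real m) * (1 / 2) powr (t - real m)"
        using r powr_mult[of r "1 / 2" "t - real m"] by simp
      have "r powr (real m - t) * (b * (r / 2) powr (t - real m))
          = r powr (real m - t) * r powr (t - real m) * K"
        unfolding halve K_def by (simp only: mult_ac)
      also have "\<dots> = K" using r by (simp flip: powr_add)
      finally show "r powr (real m - t) * (b * (r / 2) powr (t - real m)) \<le> K" by simp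
    qed (use r b K c in auto)
    then show ?thesis using K c by (intro exI[of _ "K * c"]) auto
  qed
  moreover have "\<exists>C>0. \<forall>r\<in>{0<..r0}. nbhd F r \<subseteq> \<Omega> \<longrightarrow> ennreal (inverse (ln (inverse r))) \<le>
                 ennreal C * (\<integral>\<^sup>+\<alpha>. emeasure h (\<pi> \<alpha> ` nbhd F r) \<partial>\<psi>)"
    if t: "t = real m" and r0: "r0 \<in> {0<..<1}" for r0
  proof -
    \<comment> \<open>With \<open>l = ln (inverse r)\<close> the energy bound is linear in
      \<open>l\<close>. Dividing by \<open>l\<close> leaves its slope plus a remainder that is
      largest at \<open>r = r0\<close>.\<close>
    define K where "K = C * 2 ^ m / ln 2 + (C * 2 ^ m * 2 + 2) / ln (inverse r0)"
    have l0: "0 < ln (inverse r0)" using r0 by (simp add: one_less_inverse_iff)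
    have K: "0 < K" unfolding K_def using l0 C by (intro add_pos_pos divide_pos_pos) auto
    have "ennreal (inverse (ln (inverse r))) \<le> ennreal (K * c) * (\<integral>\<^sup>+\<alpha>. emeasure h (\<pi> \<alpha> ` nbhd F r) \<partial>\<psi>)"
      if r: "0 < r" "r \<le> r0" "nbhd F r \<subseteq> \<Omega>" for r
    proof (rule ennreal_le_rescale)
      define l where "l = ln (inverse r)"
      have l: "ln (inverse r0) \<le> l" using r by (simp add: l_def)
      have lg: "log 2 (1 / (r / 2)) = l / ln 2 + 1"
        using r by (simp add: log_def l_def ln_div ln_inverse field_simps)
      let ?B = "C * 2 ^ m * (log 2 (1 / (r / 2)) + 1) + 2"
      show B: "0 < ?B"
        unfolding lg using l l0 C by (intro add_nonneg_pos mult_nonneg_nonneg add_nonneg_nonneg) auto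
      show "ennreal (1 / ?B) \<le> ennreal c * (\<integral>\<^sup>+\<alpha>. emeasure h (\<pi> \<alpha> ` nbhd F r) \<partial>\<psi>)"
      proof (rule key[OF r(1,3) B])
        fix x assume "x \<in> F"
        then show "(\<Sum>k. ennreal (1 / (2 ^ k * (r / 2)) ^ m) * emeasure \<mu> (ball x (2 ^ Suc k * (r / 2)))) \<le> ennreal ?B"
          using r r0 dim(1) C gr[of x] by (intro dyadic_sum_critical mu) (auto simp: t powr_realpow)
      qed
      have "inverse l * ?B = C * 2 ^ m / ln 2 + (C * 2 ^ m * 2 + 2) / l"
        unfolding lg using l l0 by (simp add: field_simps)
      also have "\<dots> \<le> K"
        unfolding K_def using l l0 C by (intro add_left_mono divide_left_mono) auto
      finally show "inverse (ln (inverse r)) * ?B \<le> K" unfolding l_def .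
    qed (use K c in auto)
    then show ?thesis using K c by (intro exI[of _ "K * c"]) auto
  qed
  ultimately show ?thesis by blast
qed

end
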